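(* Let $d\ge3$ and let $\mathcal{T}\in\mathbb{R}^{n_1\times\cdots\times n_d}$ have a CP-decomposition $\mathcal{T}=[[\mathbf{A}^{(1)},\dots,\mathbf{A}^{(d)}]]$ with $\mathbf{A}^{(k)}\in\mathbb{R}^{n_k\times r}$. Let $s\ge1$ be an integer, $\delta\in(0,1)$, $\mu_0>0$. Suppose that (a) $\mu(\mathbf{A}^{(1)})\le\mu_0$; (b) $\operatorname{rank}(\mathbf{A}^{(1)})=\operatorname{rank}(\mathbf{A}^{(2)})=r$; (c) every $s\times r$ submatrix of $\mathbf{A}^{(3)}$ has Kruskal rank $\ge2$; (d) for $k=3,\dots,d$, $\mathbf{A}^{(k)}$ has no entries which are exactly $0$. Then, with probability at least $1-s\delta$, the Adaptive Tensor Deli algorithm (described in the context) completes $\mathcal{T}$ (recovers factor matrices whose CP tensor equals $\mathcal{T}$) and uses at most $$O(s\mu_0 n_2 r\log(r/\delta))+s n_1 r+r\sum_{k=3}^d n_k$$ samples of $\mathcal{T}$.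
   Context: Notation: $[n]=\{1,\dots,n\}$; $[[\mathbf{A}^{(1)},\dots,\mathbf{A}^{(d)}]]=\sum_{\ell=1}^r\mathbf{a}^{(1)}_\ell\circ\cdots\circ\mathbf{a}^{(d)}_\ell$ with $\mathbf{a}^{(k)}_\ell$ the columns of $\mathbf{A}^{(k)}$. Coherence of an $n\times r$ matrix: $\mu(\mathbf{M})=\frac{n}{r}\max_{i}\|\mathrm{proj}_{\mathrm{col}(\mathbf{M})}\mathbf{e}_i\|_2^2$. Kruskal rank: largest $k$ with every $k$ columns linearly independent. Khatri–Rao product $\mathbf{A}^{(1)}\odot\mathbf{A}^{(2)}$: the $n_1n_2\times r$ matrix whose row $(i_1,i_2)$ is the entrywise product of rows $i_1$ of $\mathbf{A}^{(1)}$ and $i_2$ of $\mathbf{A}^{(2)}$. Subroutines. (i) Adaptive matrix completion (Balcan–Zhang 2016) of $\mathbf{M}\in\mathbb{R}^{n_1\times n_2}$ with parameters $\mu_0,r,\delta$: process columns one at a time keeping a matrix $\mathbf{B}$ (initially empty) of fully observed columns and a random row set $\Lambda\subset[n_1]$ of size $w=\min\{\lceil C\mu_0r\log(r/\delta)\rceil,n_1\}$ ($C$ absolute constant); observe $\mathbf{M}_{\Lambda,i}$; if it lies in $\mathrm{col}(\mathbf{B}_{\Lambda,:})$ set $\mathbf{M}_{:,i}=\mathbf{B}\mathbf{B}_{\Lambda,:}^\dagger\mathbf{M}_{\Lambda,i}$, else observe the whole column, append it to $\mathbf{B}$ and redraw $\Lambda$. (ii) Jennrich's algorithm on $\mathcal{X}\in\mathbb{R}^{n_1\times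 n_2\times s}$: with random $\mathbf{u},\mathbf{v}\in\mathbb{R}^s$, form $\mathbf{X}_\mathbf{u}=\sum_ju_j\mathcal{X}_{:,:,j}$, $\mathbf{X}_\mathbf{v}=\sum_jv_j\mathcal{X}_{:,:,j}$, and pair eigenvectors of $\mathbf{X}_\mathbf{u}\mathbf{X}_\mathbf{v}^\dagger$ and $\mathbf{X}_\mathbf{v}\mathbf{X}_\mathbf{u}^\dagger$ having reciprocal eigenvalues, giving paired mode-1 and mode-2 factor columns. (iii) Slice-by-slice censored least squares: given observed entries $\Omega$ of an order-3 tensor $\mathcal{X}\in\mathbb{R}^{n_1\times n_2\times n}$ and $\mathbf{A}^{(1)},\mathbf{A}^{(2)}$, for each $i\in[n]$ solve $\sum_{\ell=1}^r\mathbf{A}^{(1)}_{i_1,\ell}\mathbf{A}^{(2)}_{i_2,\ell}\mathbf{C}_{i,\ell}=\mathcal{X}_{i_1,i_2,i}$ over all $(i_1,i_2)$ with $(i_1,i_2,i)\in\Omega$, returning $\mathbf{C}\in\mathbb{R}^{n\times r}$. Algorithm (Adaptive Tensor Deli): (1) pick any $S\subset[n_3]$ with $|S|=s$ and any indices $i_3^*\in[n_3],\dots,i_d^*\in[n_d]$; (2) for each $i_3\in S$ sample and complete $\mathcal{T}_{:,:,i_3,i_4^*,\dots,i_d^*}$ with the adaptive matrix completion subroutine; (3) apply Jennrich's algorithm to the completed $\mathcal{T}_{:,:,S,i_4^*,\dots,i_d^*}$ to obtain $\mathbf{A}^{(1)},\mathbf{A}^{(2)}$; (4) perform QR decomposition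 with pivoting on $(\mathbf{A}^{(1)}\odot\mathbf{A}^{(2)})^T$ to find $r$ linearly independent rows of $\mathbf{A}^{(1)}\odot\mathbf{A}^{(2)}$, with index set $L\subset[n_1]\times[n_2]$; (5) for $k=3,\dots,d$: sample $\mathcal{T}_{i_1,i_2,i_3^*,\dots,i_{k-1}^*,i_k,i_{k+1}^*,\dots,i_d^*}$ for $(i_1,i_2)\in L$, $i_k\in[n_k]$, and set $\mathbf{A}^{(k)}$ to the output of censored least squares on the subtensor $\mathcal{T}_{:,:,i_3^*,\dots,i_{k-1}^*,:,i_{k+1}^*,\dots,i_d^*}$ with observed set $L\times[n_k]$; (6) for each $\ell\in[r]$ replace $\mathbf{A}^{(d)}_{:,\ell}$ by $\left(\prod_{k=3}^{d-1}\mathbf{A}^{(k)}_{i_k^*,\ell}\right)^{-1}\mathbf{A}^{(d)}_{:,\ell}$; return $\mathbf{A}^{(1)},\dots,\mathbf{A}^{(d)}$.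
   Formalization: In Jennrich's algorithm X_v X_u^† is replaced by X_v^T (X_u^T)^†, since the former yields mode-1 columns again rather than mode-2; the O-term is written with max{1, μ0 r log(r/δ)}, which equals μ0 r log(r/δ) here because μ0≥1 and r≥2. *)

theory Defs
  imports "HOL-Probability.Probability"
begin

text \<open>Matrices are functions nat => nat => real; only the entries with row index
  below the number of rows and column index below the number of columns matter.
  Modes of an order-d tensor are numbered 0,...,d-1 (paper mode k is mode k-1 here).
  A tensor is a function on index lists of length d.\<close>

type_synonym mat = "nat \<Rightarrow> nat \<Rightarrow> real"

definition tensor_index_set :: "nat \<Rightarrow> (nat \<Rightarrow> nat) \<Rightarrow> nat list set" where
  "tensor_index_set d ns = {idx. length idx = d \<and> (\<forall>k<d. idx ! k < ns k)}"

definition cp_entry :: "nat \<Rightarrow> nat \<Rightarrow> (nat \<Rightarrow> mat) \<Rightarrow> nat list \<Rightarrow> real" where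
  "cp_entry d r A idx = (\<Sum>l<r. \<Prod>k<d. A k (idx ! k) l)"

definition indep_cols :: "nat set \<Rightarrow> mat \<Rightarrow> nat set \<Rightarrow> bool" where
  "indep_cols R M J \<longleftrightarrow> (\<forall>c. (\<forall>i\<in>R. (\<Sum>l\<in>J. M i l * c l) = 0) \<longrightarrow> (\<forall>l\<in>J. c l = 0))"

definition mat_rank :: "nat \<Rightarrow> nat \<Rightarrow> mat \<Rightarrow> nat" where
  "mat_rank m r M = Max {card J | J. J \<subseteq> {..<r} \<and> indep_cols {..<m} M J}"

definition kruskal_rank :: "nat set \<Rightarrow> nat \<Rightarrow> mat \<Rightarrow> nat" where
  "kruskal_rank R r M =
     (GREATEST k. k \<le> r \<and> (\<forall>J. J \<subseteq> {..<r} \<and> card J = k \<longrightarrow> indep_cols R M J))"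

definition col_space :: "nat \<Rightarrow> nat \<Rightarrow> mat \<Rightarrow> (nat \<Rightarrow> real) set" where
  "col_space n r M = {v. \<exists>c. \<forall>i. v i = (if i < n then (\<Sum>l<r. M i l * c l) else 0)}"

definition proj_sq_norm :: "nat \<Rightarrow> nat \<Rightarrow> mat \<Rightarrow> nat \<Rightarrow> real" where
  "proj_sq_norm n r M i = (THE x. \<exists>p\<in>col_space n r M.
      (\<forall>z\<in>col_space n r M. (\<Sum>j<n. ((if j = i then 1 else 0) - p j) * z j) = 0)
      \<and> x = (\<Sum>j<n. (p j)\<^sup>2))"

definition coherence :: "nat \<Rightarrow> nat \<Rightarrow> mat \<Rightarrow> real" where
  "coherence n r M = real n / real r * Max (proj_sq_norm n r M ` {..<n})"

definition matmul :: "nat \<Rightarrow> mat \<Rightarrow> mat \<Rightarrow> mat" where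
  "matmul k A B = (\<lambda>i j. \<Sum>t<k. A i t * B t j)"

definition pinv :: "nat \<Rightarrow> nat \<Rightarrow> mat \<Rightarrow> mat" where
  "pinv m n A = (THE P. (\<forall>i j. \<not> (i < n \<and> j < m) \<longrightarrow> P i j = 0) \<and>
       (\<forall>i<m. \<forall>j<n. matmul m (matmul n A P) A i j = A i j) \<and>
       (\<forall>i<n. \<forall>j<m. matmul n (matmul m P A) P i j = P i j) \<and>
       (\<forall>i<m. \<forall>j<m. matmul n A P i j = matmul n A P j i) \<and>
       (\<forall>i<n. \<forall>j<n. matmul m P A i j = matmul m P A j i))"

subsection \<open>Adaptive matrix completion (Balcan--Zhang)\<close>

text \<open>Coefficients B_{Lambda,:}^dagger M_{Lambda,i}, where B consists of the columns J of M
  (in the consistent case this is the minimum-norm exact solution).\<close>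
definition min_norm_coeffs :: "mat \<Rightarrow> nat list \<Rightarrow> nat set \<Rightarrow> nat \<Rightarrow> (nat \<Rightarrow> real)" where
  "min_norm_coeffs M J Lam i = (THE c. (\<forall>j. j \<notin> set J \<longrightarrow> c j = 0) \<and>
      (\<forall>a\<in>Lam. (\<Sum>j\<in>set J. M a j * c j) = M a i) \<and>
      (\<forall>c'. (\<forall>j. j \<notin> set J \<longrightarrow> c' j = 0) \<and> (\<forall>a\<in>Lam. (\<Sum>j\<in>set J. M a j * c' j) = M a i)
          \<longrightarrow> (\<Sum>j\<in>set J. (c j)\<^sup>2) \<le> (\<Sum>j\<in>set J. (c' j)\<^sup>2)))"

text \<open>State: (indices of fully observed columns forming B, number of row sets drawn so far
  minus one, completed matrix, list of sampled positions (with repetition)).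
  Lams t is the t-th random row set drawn.\<close>
type_synonym amc_state = "nat list \<times> nat \<times> mat \<times> (nat \<times> nat) list"

definition amc_step :: "nat \<Rightarrow> mat \<Rightarrow> (nat \<Rightarrow> nat set) \<Rightarrow> nat \<Rightarrow> amc_state \<Rightarrow> amc_state" where
  "amc_step n1 M Lams i st = (case st of (J, t, Mc, obs) \<Rightarrow>
     (let Lam = Lams t; part = map (\<lambda>a. (a, i)) (sorted_list_of_set Lam) in
      if (\<exists>c. \<forall>a\<in>Lam. M a i = (\<Sum>j\<in>set J. M a j * c j))
      then (J, t, (\<lambda>a b. if b = i then (\<Sum>j\<in>set J. M a j * min_norm_coeffs M J Lam i j) else Mc a b),
            obs @ part)
      else (J @ [i], Suc t, (\<lambda>a b. if b = i then M a i else Mc a b),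
            obs @ part @ map (\<lambda>a. (a, i)) [0..<n1])))"

definition amc :: "nat \<Rightarrow> nat \<Rightarrow> mat \<Rightarrow> (nat \<Rightarrow> nat set) \<Rightarrow> amc_state" where
  "amc n1 n2 M Lams = fold (amc_step n1 M Lams) [0..<n2] ([], 0, (\<lambda>_ _. 0), [])"

definition amc_rows :: "real \<Rightarrow> real \<Rightarrow> nat \<Rightarrow> real \<Rightarrow> nat \<Rightarrow> nat" where
  "amc_rows C mu0 r \<delta> n1 = min (nat \<lceil>C * mu0 * real r * ln (real r / \<delta>)\<rceil>) n1"

definition fiber_index :: "nat \<Rightarrow> (nat \<Rightarrow> nat) \<Rightarrow> nat \<Rightarrow> nat \<Rightarrow> nat \<Rightarrow> nat \<Rightarrow> nat list" where
  "fiber_index d istar k i1 i2 i =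
     map (\<lambda>m. if m = 0 then i1 else if m = 1 then i2 else if m = k then i else istar m) [0..<d]"

definition slice_of :: "nat \<Rightarrow> (nat list \<Rightarrow> real) \<Rightarrow> (nat \<Rightarrow> nat) \<Rightarrow> nat \<Rightarrow> mat" where
  "slice_of d T istar i3 = (\<lambda>i1 i2. T (fiber_index d istar 2 i1 i2 i3))"

text \<open>Random tape: for every slice i3 in S an independent sequence of uniformly random row
  sets of size w (at most n2+1 draws are ever needed), and Jennrich's random vectors u, v
  (i.i.d. standard Gaussian entries).\<close>
type_synonym atd_omega = "(nat \<Rightarrow> nat \<Rightarrow> nat set) \<times> (nat \<Rightarrow> real) \<times> (nat \<Rightarrow> real)"

definition amc_tapes :: "nat set \<Rightarrow> nat \<Rightarrow> nat \<Rightarrow> nat \<Rightarrow> (nat \<Rightarrow> nat \<Rightarrow> nat set) set" where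
  "amc_tapes S n1 n2 w = {f. \<forall>i3 t. if i3 \<in> S \<and> t \<le> n2
       then f i3 t \<subseteq> {..<n1} \<and> card (f i3 t) = w else f i3 t = {}}"

definition atd_space :: "nat set \<Rightarrow> nat \<Rightarrow> nat \<Rightarrow> nat \<Rightarrow> atd_omega measure" where
  "atd_space S n1 n2 w =
     measure_pmf (pmf_of_set (amc_tapes S n1 n2 w)) \<Otimes>\<^sub>M
       (Pi\<^sub>M {..<card S} (\<lambda>_. density lborel std_normal_density) \<Otimes>\<^sub>M
        Pi\<^sub>M {..<card S} (\<lambda>_. density lborel std_normal_density))"

definition atd_completed :: "nat \<Rightarrow> (nat \<Rightarrow> nat) \<Rightarrow> (nat list \<Rightarrow> real) \<Rightarrow> (nat \<Rightarrow> nat) \<Rightarrow> atd_omega \<Rightarrow> nat \<Rightarrow> amc_state" where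
  "atd_completed d ns T istar \<omega> i3 = amc (ns 0) (ns 1) (slice_of d T istar i3) (fst \<omega> i3)"

text \<open>Jennrich: X_u = sum_j u_j X_j; Y1 = X_u X_v^dagger (mode-1 eigenvectors);
  Y2 = X_v^T (X_u^T)^dagger (mode-2 eigenvectors, reciprocal eigenvalues).\<close>
definition jennrich_mix :: "nat set \<Rightarrow> (nat \<Rightarrow> mat) \<Rightarrow> (nat \<Rightarrow> real) \<Rightarrow> mat" where
  "jennrich_mix S X u = (\<lambda>i1 i2. \<Sum>j<card S. u j * X (sorted_list_of_set S ! j) i1 i2)"

definition is_eigvec :: "nat \<Rightarrow> mat \<Rightarrow> real \<Rightarrow> (nat \<Rightarrow> real) \<Rightarrow> bool" where
  "is_eigvec n Y lam a \<longleftrightarrow> (\<exists>i<n. a i \<noteq> 0) \<and> (\<forall>i<n. (\<Sum>j<n. Y i j * a j) = lam * a i)"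

definition jennrich_output :: "nat \<Rightarrow> nat \<Rightarrow> nat \<Rightarrow> mat \<Rightarrow> mat \<Rightarrow> mat \<Rightarrow> mat \<Rightarrow> bool" where
  "jennrich_output n1 n2 r Xu Xv A1 A2 \<longleftrightarrow>
     (let Y1 = matmul n2 Xu (pinv n1 n2 Xv);
          Y2 = (\<lambda>i j. \<Sum>t<n1. Xv t i * pinv n1 n2 Xu j t)
      in \<exists>lam. inj_on lam {..<r} \<and> (\<forall>l<r. lam l \<noteq> 0 \<and>
             is_eigvec n1 Y1 (lam l) (\<lambda>i. A1 i l) \<and> is_eigvec n2 Y2 (1 / lam l) (\<lambda>i. A2 i l)))"

definition kr_independent_rows :: "nat \<Rightarrow> nat \<Rightarrow> nat \<Rightarrow> mat \<Rightarrow> mat \<Rightarrow> (nat \<times> nat) set \<Rightarrow> bool" where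
  "kr_independent_rows n1 n2 r A1 A2 L \<longleftrightarrow> L \<subseteq> {..<n1} \<times> {..<n2} \<and> card L = r \<and>
     (\<forall>y. (\<forall>l<r. (\<Sum>p\<in>L. y p * (A1 (fst p) l * A2 (snd p) l)) = 0) \<longrightarrow> (\<forall>p\<in>L. y p = 0))"

text \<open>An admissible execution of steps 1-4 on the random outcome omega yields (A1, A2, L).\<close>
definition atd_admissible :: "nat \<Rightarrow> (nat \<Rightarrow> nat) \<Rightarrow> nat \<Rightarrow> (nat list \<Rightarrow> real) \<Rightarrow> nat set \<Rightarrow>
    (nat \<Rightarrow> nat) \<Rightarrow> atd_omega \<Rightarrow> mat \<Rightarrow> mat \<Rightarrow> (nat \<times> nat) set \<Rightarrow> bool" where
  "atd_admissible d ns r T S istar \<omega> A1 A2 L \<longleftrightarrow>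
     (let X = (\<lambda>i3. fst (snd (snd (atd_completed d ns T istar \<omega> i3)))) in
      jennrich_output (ns 0) (ns 1) r (jennrich_mix S X (fst (snd \<omega>))) (jennrich_mix S X (snd (snd \<omega>))) A1 A2
      \<and> kr_independent_rows (ns 0) (ns 1) r A1 A2 L)"

text \<open>Step 5: slice-by-slice censored least squares with observed set L x [n_k]
  (square system with invertible matrix, so the least squares solution is the exact one).\<close>
definition cls_factor :: "nat \<Rightarrow> nat \<Rightarrow> (nat list \<Rightarrow> real) \<Rightarrow> (nat \<Rightarrow> nat) \<Rightarrow> mat \<Rightarrow> mat \<Rightarrow>
    (nat \<times> nat) set \<Rightarrow> nat \<Rightarrow> mat" where
  "cls_factor d r T istar A1 A2 L k = (\<lambda>i. THE c. (\<forall>l. r \<le> l \<longrightarrow> c l = 0) \<and>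
      (\<forall>p\<in>L. (\<Sum>l<r. A1 (fst p) l * A2 (snd p) l * c l) = T (fiber_index d istar k (fst p) (snd p) i)))"

definition atd_factors :: "nat \<Rightarrow> nat \<Rightarrow> (nat list \<Rightarrow> real) \<Rightarrow> (nat \<Rightarrow> nat) \<Rightarrow> mat \<Rightarrow> mat \<Rightarrow>
    (nat \<times> nat) set \<Rightarrow> nat \<Rightarrow> mat" where
  "atd_factors d r T istar A1 A2 L = (\<lambda>k.
     if k = 0 then A1 else if k = 1 then A2
     else if k = d - 1 then (\<lambda>i l. cls_factor d r T istar A1 A2 L (d - 1) i l /
              (\<Prod>k'\<in>{2..<d - 1}. cls_factor d r T istar A1 A2 L k' (istar k') l))
     else cls_factor d r T istar A1 A2 L k)"

definition atd_queries :: "nat \<Rightarrow> (nat \<Rightarrow> nat) \<Rightarrow> (nat list \<Rightarrow> real) \<Rightarrow> nat set \<Rightarrow> (nat \<Rightarrow> nat) \<Rightarrow>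
    atd_omega \<Rightarrow> (nat \<times> nat) set \<Rightarrow> nat list list" where
  "atd_queries d ns T S istar \<omega> L =
     concat (map (\<lambda>i3. map (\<lambda>(a, b). fiber_index d istar 2 a b i3)
                     (snd (snd (snd (atd_completed d ns T istar \<omega> i3)))))
             (sorted_list_of_set S))
   @ concat (map (\<lambda>k. concat (map (\<lambda>p. map (\<lambda>i. fiber_index d istar k (fst p) (snd p) i) [0..<ns k])
                                 (filter (\<lambda>p. p \<in> L) (List.product [0..<ns 0] [0..<ns 1])))) [2..<d])"

end

theory Submission
  imports Defs
begin

text \<open>Every completed slice is a matrix A0 D A1^T with D diagonal and invertible, so its columns span
  W = col(A0). A row set Lambda is harmless as soon as no nonzero vector of W vanishes on it. Let f(Lambda)
  be the dimension of the subspace of W vanishing on Lambda. By the coherence bound an orthonormal basis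
  of this subspace has mass at most mu0 r / n1 in each row, so at least f(Lambda) n1 / (mu0 r) rows are
  not identically zero on it, and adding any of them to Lambda lowers f. Averaging over all w-subsets
  gives E f <= r exp(-w / (mu0 r)), and a union bound over the s slices and the at most r + 1 row sets
  each of them uses gives the probability s delta, already for C = 3.

  If all row sets are harmless, matrix completion is exact and reads at most r full columns per slice.
  For Gaussian u, v the mixtures are A0 D_u A1^T and A0 D_v A1^T, where almost surely D_u and D_v are
  invertible and the ratios of their diagonals are pairwise distinct; hence Jennrich's algorithm finds the columns of A0
  and A1 up to a common permutation and nonzero scalings. The square systems of the last step then
  determine the other factors, and the scalings cancel in the product.\<close>

section \<open>Linear systems and orthonormal families\<close>

text \<open>The obstacle is adaptivity: which columns form B, and so which draw is in use, depends
  on earlier draws. Harmlessness is therefore stated for W, which depends on A0 alone, and not for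
  the current span of B. It can then be demanded in advance of the draws 0, ..., r of all slices,
  with no conditioning, and completion is deterministic on that event. Dimension is measured by
  orthonormal families because coherence bounds exactly the mass that such a family has in a row.
  The constant 3 pays for the factor r in the bound on E f and for the r + 1 draws: (r + 1) r
  (\<delta>/r)^3 \<le> \<delta> once r + 1 \<le> r^2, and r \<ge> 2 comes from the Kruskal rank.
  Jennrich's algorithm and pivoting leave choices open, so correctness has to hold for every
  admissible choice, and existence of one is proved separately.\<close>

lemma sum_mult_delta:
  fixes y :: "'a \<Rightarrow> real"
  assumes "finite R" "k \<in> R"
  shows "(\<Sum>i\<in>R. y i * (if i = k then 1 else 0)) = y k"
proof -
  have "(\<Sum>i\<in>R. y i * (if i = k then 1 else 0)) = (\<Sum>i\<in>R. if i = k then y i else 0)"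
    by (rule sum.cong) auto
  then show ?thesis using assms by simp
qed

text \<open>Gaussian elimination, by induction on the equations: a pivot \<open>j0\<close> of
  equation \<open>k\<close> is eliminated from the other equations, the smaller system is solved,
  and the value at \<open>j0\<close> is recovered by back-substitution.\<close>

lemma underdetermined:
  fixes M :: "'a \<Rightarrow> 'b \<Rightarrow> real"
  assumes "finite R" "finite J" "card R < card J"
  shows "\<exists>c. (\<exists>j\<in>J. c j \<noteq> 0) \<and> (\<forall>i\<in>R. (\<Sum>j\<in>J. M i j * c j) = 0)"
  using assms
proof (induction R arbitrary: J M rule: finite_induct)
  case empty
  then have "J \<noteq> {}" by auto
  then show ?case by (intro exI[of _ "\<lambda>_. 1"]) auto
next
  case (insert k R)
  show ?case
  proof (cases "\<forall>j\<in>J. M k j = 0")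
    case True
    obtain c where "\<exists>j\<in>J. c j \<noteq> 0" "\<forall>i\<in>R. (\<Sum>j\<in>J. M i j * c j) = 0"
      using insert.IH[of J M] insert.prems insert.hyps by auto
    then show ?thesis using True by (intro exI[of _ c]) auto
  next
    case False
    then obtain j0 where j0: "j0 \<in> J" "M k j0 \<noteq> 0" by auto
    let ?J = "J - {j0}"
    let ?M = "\<lambda>i j. M i j - M i j0 * M k j / M k j0"
    have "card R < card ?J" using insert.prems insert.hyps j0 by simp
    then obtain c where c: "\<exists>j\<in>?J. c j \<noteq> 0" "\<forall>i\<in>R. (\<Sum>j\<in>?J. ?M i j * c j) = 0"
      using insert.IH[of ?J ?M] insert.prems by auto
    define z where "z = - (\<Sum>j\<in>?J. M k j * c j) / M k j0"
    define c' where "c' = c(j0 := z)"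
    have split: "(\<Sum>j\<in>J. M i j * c' j) = M i j0 * z + (\<Sum>j\<in>?J. M i j * c j)" for i
    proof -
      have "(\<Sum>j\<in>J. M i j * c' j) = M i j0 * c' j0 + (\<Sum>j\<in>?J. M i j * c' j)"
        using j0 insert.prems by (simp add: sum.remove)
      also have "(\<Sum>j\<in>?J. M i j * c' j) = (\<Sum>j\<in>?J. M i j * c j)"
        by (rule sum.cong) (auto simp: c'_def)
      finally show ?thesis by (simp add: c'_def)
    qed
    have "(\<Sum>j\<in>J. M i j * c' j) = 0" if "i \<in> insert k R" for i
    proof (cases "i = k")
      case True
      then show ?thesis using split[of k] j0 by (simp add: z_def)
    next
      case False
      then have "i \<in> R" using that by auto
      then have "0 = (\<Sum>j\<in>?J. ?M i j * c j)" using c by auto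
      also have "\<dots> = (\<Sum>j\<in>?J. M i j * c j - M i j0 / M k j0 * (M k j * c j))"
        by (rule sum.cong) (auto simp: algebra_simps)
      also have "\<dots> = (\<Sum>j\<in>?J. M i j * c j) - M i j0 / M k j0 * (\<Sum>j\<in>?J. M k j * c j)"
        by (simp add: sum_subtractf sum_distrib_left)
      also have "\<dots> = (\<Sum>j\<in>J. M i j * c' j)"
        unfolding split z_def by simp
      finally show ?thesis by simp
    qed
    moreover have "\<exists>j\<in>J. c' j \<noteq> 0" using c by (auto simp: c'_def)
    ultimately show ?thesis by blast
  qed
qed

text \<open>The right-hand side is adjoined as an extra column with index \<open>None\<close>. The
  enlarged system has more unknowns than equations, and injectivity forces a nontrivial kernel
  vector to be nonzero at \<open>None\<close>; division by the negative of that entry gives the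
  solution.\<close>

lemma square_solvable:
  fixes M :: "'a \<Rightarrow> 'b \<Rightarrow> real"
  assumes "finite R" "finite J" "card R = card J"
    and inj: "\<And>c. (\<forall>i\<in>R. (\<Sum>j\<in>J. M i j * c j) = 0) \<Longrightarrow> \<forall>j\<in>J. c j = 0"
  shows "\<exists>c. \<forall>i\<in>R. (\<Sum>j\<in>J. M i j * c j) = b i"
proof -
  let ?J = "insert None (Some ` J)"
  let ?M = "\<lambda>i j. case j of None \<Rightarrow> b i | Some j \<Rightarrow> M i j"
  have "card ?J = Suc (card J)" using assms by (simp add: card_image)
  then obtain c where c: "\<exists>j\<in>?J. c j \<noteq> 0" "\<forall>i\<in>R. (\<Sum>j\<in>?J. ?M i j * c j) = 0"
    using underdetermined[of R ?J ?M] assms by auto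
  have split: "(\<Sum>j\<in>?J. ?M i j * c j) = b i * c None + (\<Sum>j\<in>J. M i j * c (Some j))" for i
    using assms(2) by (subst sum.insert) (auto simp: sum.reindex)
  have nz: "c None \<noteq> 0"
  proof
    assume "c None = 0"
    then have "\<forall>j\<in>J. c (Some j) = 0" using inj[of "\<lambda>j. c (Some j)"] c split by simp
    then show False using c \<open>c None = 0\<close> by auto
  qed
  have "(\<Sum>j\<in>J. M i j * (- c (Some j) / c None)) = b i" if "i \<in> R" for i
  proof -
    have "(\<Sum>j\<in>J. M i j * (- c (Some j) / c None)) = - (\<Sum>j\<in>J. M i j * c (Some j)) / c None"
      by (simp add: sum_divide_distrib sum_negf)
    also have "\<dots> = b i"
    proof -
      have "b i * c None + (\<Sum>j\<in>J. M i j * c (Some j)) = 0"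
        using c(2) that unfolding split by blast
      then show ?thesis using nz by (simp add: field_simps)
    qed
    finally show ?thesis .
  qed
  then show ?thesis by (intro exI[of _ "\<lambda>j. - c (Some j) / c None"]) simp
qed

text \<open>Pairing \<open>y\<close> with the solution \<open>c\<close> of M c = e_k gives y_k = y^T
  M c = 0. This turns independence of the rows of a square system into uniqueness of its
  solution.\<close>

lemma square_transpose_inj:
  fixes M :: "'a \<Rightarrow> 'b \<Rightarrow> real"
  assumes "finite R" "finite J" "card R = card J"
    and inj: "\<And>c. (\<forall>i\<in>R. (\<Sum>j\<in>J. M i j * c j) = 0) \<Longrightarrow> \<forall>j\<in>J. c j = 0"
    and y: "\<forall>j\<in>J. (\<Sum>i\<in>R. M i j * y i) = 0"
  shows "\<forall>i\<in>R. y i = 0"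
proof
  fix k assume k: "k \<in> R"
  obtain c where c: "\<forall>i\<in>R. (\<Sum>j\<in>J. M i j * c j) = (if i = k then 1 else 0)"
  proof -
    have "\<exists>c. \<forall>i\<in>R. (\<Sum>j\<in>J. M i j * c j) = (if i = k then 1 else 0)"
      by (rule square_solvable[OF assms(1-3)]) (rule inj)
    then show thesis by (elim exE) (rule that)
  qed
  have "y k = (\<Sum>i\<in>R. y i * (if i = k then 1 else 0))"
    using sum_mult_delta[OF assms(1) k, of y] by simp
  also have "\<dots> = (\<Sum>i\<in>R. y i * (\<Sum>j\<in>J. M i j * c j))" using c by (intro sum.cong) auto
  also have "\<dots> = (\<Sum>i\<in>R. \<Sum>j\<in>J. c j * (M i j * y i))"
    by (simp add: sum_distrib_left mult_ac)
  also have "\<dots> = (\<Sum>j\<in>J. c j * (\<Sum>i\<in>R. M i j * y i))"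
    by (subst sum.swap) (simp add: sum_distrib_left)
  also have "\<dots> = 0" using y by simp
  finally show "y k = 0" .
qed

text \<open>A maximal independent set \<open>L\<close> of rows has the required size: with fewer
  than \<open>card J\<close> rows some nonzero \<open>c\<close> is annihilated by all of
  \<open>L\<close>, and by injectivity a further row does not annihilate \<open>c\<close>, so it
  could be added. Applied to the Khatri-Rao product this supplies the pivot rows.\<close>

lemma independent_rows_exist:
  fixes M :: "'a \<Rightarrow> 'b \<Rightarrow> real"
  assumes "finite P" "finite J"
    and inj: "\<And>c. (\<forall>i\<in>P. (\<Sum>j\<in>J. M i j * c j) = 0) \<Longrightarrow> \<forall>j\<in>J. c j = 0"
  shows "\<exists>L\<subseteq>P. card L = card J \<and> (\<forall>y. (\<forall>j\<in>J. (\<Sum>i\<in>L. y i * M i j) = 0) \<longrightarrow> (\<forall>i\<in>L. y i = 0))"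
proof -
  define Ind where "Ind L \<longleftrightarrow> (\<forall>y. (\<forall>j\<in>J. (\<Sum>i\<in>L. y i * M i j) = 0) \<longrightarrow> (\<forall>i\<in>L. y i = 0))" for L
  define F where "F = {L. L \<subseteq> P \<and> Ind L}"
  have "finite F" using assms(1) by (simp add: F_def)
  moreover have "{} \<in> F" by (auto simp: F_def Ind_def)
  ultimately obtain L where "L \<in> F" and F: "\<forall>L'\<in>F. L \<subseteq> L' \<longrightarrow> L = L'"
    using finite_has_maximal2[of F "{}"] by auto
  then have L: "L \<subseteq> P" "Ind L" by (auto simp: F_def)
  have max: "L' = L" if "L' \<subseteq> P" "Ind L'" "L \<subseteq> L'" for L'
    using F that by (auto simp: F_def)
  have fL: "finite L" using L assms finite_subset by blast
  have "card L \<le> card J"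
  proof (rule ccontr)
    assume "\<not> ?thesis"
    then obtain y where "\<exists>i\<in>L. y i \<noteq> 0" "\<forall>j\<in>J. (\<Sum>i\<in>L. M i j * y i) = 0"
      using underdetermined[of J L "\<lambda>j i. M i j"] fL assms by auto
    then show False using L(2) unfolding Ind_def by (auto simp: mult.commute)
  qed
  moreover have "\<not> card L < card J"
  proof
    assume "card L < card J"
    then obtain c where c: "\<exists>j\<in>J. c j \<noteq> 0" "\<forall>i\<in>L. (\<Sum>j\<in>J. M i j * c j) = 0"
      using underdetermined[of L J M] fL assms by auto
    then obtain p where p: "p \<in> P" "(\<Sum>j\<in>J. M p j * c j) \<noteq> 0" using inj[of c] by auto
    then have pL: "p \<notin> L" using c by auto
    have "Ind (insert p L)"
      unfolding Ind_def
    proof (intro allI impI)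
      fix y assume y: "\<forall>j\<in>J. (\<Sum>i\<in>insert p L. y i * M i j) = 0"
      \<comment> \<open>Contracting the relation with \<open>c\<close> removes every row of
        \<open>L\<close> and leaves only the term of \<open>p\<close>.\<close>
      have "0 = (\<Sum>j\<in>J. c j * (\<Sum>i\<in>insert p L. y i * M i j))" using y by simp
      also have "\<dots> = (\<Sum>j\<in>J. \<Sum>i\<in>insert p L. y i * (M i j * c j))"
        by (simp only: sum_distrib_left mult_ac)
      also have "\<dots> = (\<Sum>i\<in>insert p L. y i * (\<Sum>j\<in>J. M i j * c j))"
        by (subst sum.swap) (simp only: sum_distrib_left)
      also have "\<dots> = y p * (\<Sum>j\<in>J. M p j * c j)"
        using fL pL c(2) by simp
      finally have yp: "y p = 0" using p by simp
      then have "\<forall>j\<in>J. (\<Sum>i\<in>L. y i * M i j) = 0" using y fL pL by simp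
      then show "\<forall>i\<in>insert p L. y i = 0" using L(2) yp unfolding Ind_def by blast
    qed
    then show False using max[of "insert p L"] p L pL by auto
  qed
  ultimately show ?thesis using L unfolding Ind_def by (intro exI[of _ L]) auto
qed

section \<open>Orthonormal families as a measure of dimension\<close>

definition inner_upto :: "nat \<Rightarrow> (nat \<Rightarrow> real) \<Rightarrow> (nat \<Rightarrow> real) \<Rightarrow> real" where
  "inner_upto n v w = (\<Sum>i<n. v i * w i)"

definition orthonormal_upto :: "nat \<Rightarrow> (nat \<Rightarrow> nat \<Rightarrow> real) \<Rightarrow> nat \<Rightarrow> bool" where
  "orthonormal_upto n U k \<longleftrightarrow>
     (\<forall>a<k. \<forall>b<k. inner_upto n (U a) (U b) = (if a = b then 1 else 0))"

definition linear_closed :: "(nat \<Rightarrow> real) set \<Rightarrow> bool" where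
  "linear_closed W \<longleftrightarrow> (\<forall>v\<in>W. \<forall>w\<in>W. \<forall>c. (\<lambda>i. v i + c * w i) \<in> W)"

definition has_frame :: "nat \<Rightarrow> (nat \<Rightarrow> real) set \<Rightarrow> nat \<Rightarrow> bool" where
  "has_frame n W k \<longleftrightarrow> (\<exists>U. (\<forall>a<k. U a \<in> W) \<and> orthonormal_upto n U k)"

text \<open>\<open>GREATEST\<close> has its intended value only when the sizes of frames are
  bounded; inside a column space with \<open>r\<close> columns the bound is supplied by
  \<open>has_frame_col_space_le\<close>.\<close>

definition frame_dim :: "nat \<Rightarrow> (nat \<Rightarrow> real) set \<Rightarrow> nat" where
  "frame_dim n W = (GREATEST k. has_frame n W k)"

definition frame_residual :: "nat \<Rightarrow> (nat \<Rightarrow> nat \<Rightarrow> real) \<Rightarrow> nat \<Rightarrow> (nat \<Rightarrow> real) \<Rightarrow> nat \<Rightarrow> real" where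
  "frame_residual n U k v = (\<lambda>i. v i - (\<Sum>a<k. inner_upto n v (U a) * U a i))"

lemma inner_upto_commute: "inner_upto n v w = inner_upto n w v"
  by (simp add: inner_upto_def mult.commute)

lemma inner_upto_pos: "i < n \<Longrightarrow> v i \<noteq> 0 \<Longrightarrow> 0 < inner_upto n v v"
  unfolding inner_upto_def by (rule sum_pos2[of _ i]) (auto simp: zero_less_mult_iff linorder_neq_iff)

lemma inner_upto_sum_left:
  "inner_upto n (\<lambda>i. \<Sum>a\<in>K. c a * U a i) w = (\<Sum>a\<in>K. c a * inner_upto n (U a) w)"
  unfolding inner_upto_def
  by (simp only: sum_distrib_right sum_distrib_left mult.assoc) (rule sum.swap)

lemma inner_upto_diff_left:
  "inner_upto n (\<lambda>i. v i - w i) z = inner_upto n v z - inner_upto n w z"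
  by (simp add: inner_upto_def left_diff_distrib sum_subtractf)

lemma inner_upto_frame_sum:
  assumes "orthonormal_upto n U k" "b < k"
  shows "inner_upto n (\<lambda>i. \<Sum>a<k. c a * U a i) (U b) = c b"
proof -
  have "(\<Sum>a<k. c a * inner_upto n (U a) (U b)) =
      (\<Sum>a<k. c a * (if a = b then 1 else 0))"
    using assms by (intro sum.cong) (auto simp: orthonormal_upto_def)
  also have "\<dots> = c b" using assms(2) by (intro sum_mult_delta) auto
  finally show ?thesis by (simp add: inner_upto_sum_left)
qed

lemma frame_residual_orthogonal:
  assumes "orthonormal_upto n U k" "b < k"
  shows "inner_upto n (frame_residual n U k v) (U b) = 0"
  unfolding frame_residual_def inner_upto_diff_left
  using inner_upto_frame_sum[OF assms, of "\<lambda>a. inner_upto n v (U a)"] by simp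

lemma linear_closedD:
  "linear_closed W \<Longrightarrow> v \<in> W \<Longrightarrow> w \<in> W \<Longrightarrow> (\<lambda>i. v i + c * w i) \<in> W"
  unfolding linear_closed_def by simp

lemma linear_closed_sum:
  fixes k :: nat
  assumes "linear_closed W" "v \<in> W" "\<And>a. a < k \<Longrightarrow> U a \<in> W"
  shows "(\<lambda>i. v i + (\<Sum>a<k. c a * U a i)) \<in> W"
  using assms(3)
proof (induction k)
  case 0
  then show ?case using assms by simp
next
  case (Suc k)
  then have "(\<lambda>i. v i + (\<Sum>a<k. c a * U a i)) \<in> W" "U k \<in> W" by auto
  then have "(\<lambda>i. (v i + (\<Sum>a<k. c a * U a i)) + c k * U k i) \<in> W"
    by (rule linear_closedD[OF assms(1)])
  then show ?case by (simp add: add.assoc)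
qed

lemma frame_residual_in:
  assumes "linear_closed W" "v \<in> W" "\<And>a. a < k \<Longrightarrow> U a \<in> W"
  shows "frame_residual n U k v \<in> W"
proof -
  have "(\<lambda>i. v i + (\<Sum>a<k. - inner_upto n v (U a) * U a i)) \<in> W"
    by (rule linear_closed_sum[OF assms])
  then show ?thesis by (simp add: frame_residual_def sum_negf)
qed

lemma linear_closed_scale:
  assumes "linear_closed W" "v \<in> W"
  shows "(\<lambda>i. c * v i) \<in> W"
proof -
  have "(\<lambda>i. v i + (c - 1) * v i) \<in> W" using assms by (intro linear_closedD)
  then show ?thesis by (simp add: algebra_simps)
qed

text \<open>Gram-Schmidt: the residual of \<open>v\<close> stays in \<open>W\<close>, is orthogonal
  to the frame and, being nonzero at a coordinate below \<open>n\<close>, can be normalised. Testing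
  a single coordinate suits row sets, where a vector is known only to be nonzero in a given
  row.\<close>

lemma has_frame_extend:
  assumes "linear_closed W" "\<And>a. a < k \<Longrightarrow> U a \<in> W" "orthonormal_upto n U k"
    and "v \<in> W" "i < n" "frame_residual n U k v i \<noteq> 0"
  shows "has_frame n W (Suc k)"
proof -
  let ?x = "frame_residual n U k v"
  define s where "s = sqrt (inner_upto n ?x ?x)"
  have s: "s > 0" "s * s = inner_upto n ?x ?x"
    using inner_upto_pos[of i n ?x] assms(5,6) by (auto simp: s_def)
  define y where "y = (\<lambda>j. (1 / s) * ?x j)"
  have yW: "y \<in> W" unfolding y_def
    by (intro linear_closed_scale frame_residual_in assms)
  have scl: "inner_upto n y z = (1 / s) * inner_upto n ?x z" for z
    by (simp add: y_def inner_upto_def sum_divide_distrib)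
  have yy: "inner_upto n y y = 1"
  proof -
    have "inner_upto n y y = (1/s) * ((1/s) * inner_upto n ?x ?x)"
      using scl[of y] scl[of ?x] inner_upto_commute by metis
    then show ?thesis using s(1) by (simp flip: s(2))
  qed
  have yU: "inner_upto n y (U b) = 0" if "b < k" for b
    using scl[of "U b"] frame_residual_orthogonal[OF assms(3) that] by simp
  then have Uy: "inner_upto n (U b) y = 0" if "b < k" for b
    using that by (simp add: inner_upto_commute)
  have "orthonormal_upto n (U(k := y)) (Suc k)"
    using assms(3) yy yU Uy
    by (auto simp: orthonormal_upto_def less_Suc_eq)
  then show ?thesis unfolding has_frame_def
    using assms(2) yW by (intro exI[of _ "U(k := y)"]) (auto simp: less_Suc_eq)
qed

lemma col_space_linear_closed: "linear_closed (col_space n r M)"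
  unfolding linear_closed_def
proof (intro ballI allI)
  fix v w and c :: real assume "v \<in> col_space n r M" "w \<in> col_space n r M"
  then obtain a b where "\<forall>i. v i = (if i < n then \<Sum>l<r. M i l * a l else 0)"
    "\<forall>i. w i = (if i < n then \<Sum>l<r. M i l * b l else 0)"
    unfolding col_space_def by blast
  then show "(\<lambda>i. v i + c * w i) \<in> col_space n r M"
    unfolding col_space_def
    by (intro CollectI exI[of _ "\<lambda>l. a l + c * b l"])
      (auto simp: distrib_left sum.distrib sum_distrib_left mult_ac)
qed

text \<open>More than \<open>r\<close> vectors have linearly dependent coefficient vectors in R^r,
  so a nontrivial combination of the frame is zero; pairing it with each frame vector makes all its
  coefficients zero.\<close>

lemma has_frame_col_space_le:
  assumes "has_frame n (col_space n r M) k"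
  shows "k \<le> r"
proof (rule ccontr)
  assume "\<not> k \<le> r"
  obtain U where U: "\<And>a. a < k \<Longrightarrow> U a \<in> col_space n r M" "orthonormal_upto n U k"
    using assms unfolding has_frame_def by blast
  then have "\<forall>a. \<exists>c. a < k \<longrightarrow> (\<forall>i. U a i = (if i < n then \<Sum>l<r. M i l * c l else 0))"
    unfolding col_space_def by blast
  then obtain c where c: "\<And>a i. a < k \<Longrightarrow> U a i = (if i < n then \<Sum>l<r. M i l * c a l else 0)"
    by metis
  obtain y where y: "\<exists>a\<in>{..<k}. y a \<noteq> 0" "\<forall>l\<in>{..<r}. (\<Sum>a\<in>{..<k}. c a l * y a) = 0"
    using underdetermined[of "{..<r}" "{..<k}" "\<lambda>l a. c a l"] \<open>\<not> k \<le> r\<close> by auto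
  have z: "(\<Sum>a<k. y a * U a i) = 0" if "i < n" for i
  proof -
    have "(\<Sum>a<k. y a * U a i) = (\<Sum>a<k. \<Sum>l<r. M i l * (c a l * y a))"
      using c that by (intro sum.cong) (auto simp: sum_distrib_left mult_ac)
    also have "\<dots> = (\<Sum>l<r. M i l * (\<Sum>a<k. c a l * y a))"
      by (subst sum.swap) (simp add: sum_distrib_left)
    finally show ?thesis using y by simp
  qed
  have "y b = 0" if "b < k" for b
  proof -
    have "y b = inner_upto n (\<lambda>i. \<Sum>a<k. y a * U a i) (U b)"
      using inner_upto_frame_sum[OF U(2) that, of y] by simp
    then show ?thesis using z by (simp add: inner_upto_def)
  qed
  then show False using y by auto
qed

lemma has_frame_mono: "has_frame n V k \<Longrightarrow> V \<subseteq> W \<Longrightarrow> has_frame n W k"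
  unfolding has_frame_def by blast

lemma frame_dim_props:
  assumes "V \<subseteq> col_space n r M"
  shows "has_frame n V (frame_dim n V)" "has_frame n V k \<Longrightarrow> k \<le> frame_dim n V"
    "frame_dim n V \<le> r"
proof -
  have b: "\<forall>k. has_frame n V k \<longrightarrow> k \<le> r"
    using has_frame_col_space_le has_frame_mono assms by blast
  have 0: "has_frame n V 0" by (auto simp: has_frame_def orthonormal_upto_def)
  show "has_frame n V (frame_dim n V)" unfolding frame_dim_def
    by (rule GreatestI_nat[where k = 0 and b = r]) (use 0 b in auto)
  then show "frame_dim n V \<le> r" using b by blast
  show "has_frame n V k \<Longrightarrow> k \<le> frame_dim n V" unfolding frame_dim_def
    by (rule Greatest_le_nat[where b = r]) (use b in auto)
qed

lemma frame_dim_0_imp: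
  assumes "V \<subseteq> col_space n r M" "linear_closed V" "frame_dim n V = 0" "v \<in> V" "i < n"
  shows "v i = 0"
proof (rule ccontr)
  assume "v i \<noteq> 0"
  then have "has_frame n V (Suc 0)"
    using has_frame_extend[OF assms(2), of 0 "\<lambda>_. v" n v i] assms
    by (auto simp: frame_residual_def orthonormal_upto_def)
  then show False using frame_dim_props(2)[OF assms(1)] assms(3) by fastforce
qed

text \<open>The difference of the two sides is the squared norm of the residual of
  \<open>p\<close>.\<close>

lemma bessel:
  assumes "orthonormal_upto n U k"
  shows "(\<Sum>a<k. (inner_upto n p (U a))\<^sup>2) \<le> inner_upto n p p"
proof -
  let ?c = "\<lambda>a. inner_upto n p (U a)"
  let ?x = "frame_residual n U k p"
  let ?s = "\<lambda>i. \<Sum>a<k. ?c a * U a i"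
  have "inner_upto n ?x ?x = inner_upto n p ?x - inner_upto n ?s ?x"
    by (subst (1) frame_residual_def) (rule inner_upto_diff_left)
  also have "inner_upto n ?s ?x = 0"
    unfolding inner_upto_sum_left
    using frame_residual_orthogonal[OF assms] by (simp add: inner_upto_commute)
  also have "inner_upto n p ?x = inner_upto n p p - inner_upto n ?s p"
    by (subst inner_upto_commute, subst (1) frame_residual_def) (rule inner_upto_diff_left)
  also have "inner_upto n ?s p = (\<Sum>a<k. (?c a)\<^sup>2)"
    unfolding inner_upto_sum_left by (simp add: power2_eq_square inner_upto_commute)
  finally have "inner_upto n ?x ?x = inner_upto n p p - (\<Sum>a<k. (?c a)\<^sup>2)" by simp
  moreover have "0 \<le> inner_upto n ?x ?x" unfolding inner_upto_def by (intro sum_nonneg) auto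
  ultimately show ?thesis by linarith
qed

text \<open>For a maximal frame U the vector p = sum_a U_a(i) U_a is the projection of e_i, and
  pairing with it reads off coordinate i on the column space. This also settles uniqueness in the
  definite description: a second candidate q satisfies <q,q> = q_i = <p,q> = p_i = <p,p>.\<close>

lemma proj_sq_norm_witness:
  assumes i: "i < n"
  shows "\<exists>p\<in>col_space n r M. (\<forall>z\<in>col_space n r M. z i = inner_upto n p z)
           \<and> proj_sq_norm n r M i = inner_upto n p p"
proof -
  let ?W = "col_space n r M"
  have 0: "(\<lambda>_. 0) \<in> ?W" unfolding col_space_def by (intro CollectI exI[of _ "\<lambda>_. 0"]) auto
  obtain U where U: "\<And>a. a < frame_dim n ?W \<Longrightarrow> U a \<in> ?W" "orthonormal_upto n U (frame_dim n ?W)"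
    using frame_dim_props(1)[of ?W n r M] unfolding has_frame_def by blast
  define k where "k = frame_dim n ?W"
  define p where "p = (\<lambda>j. \<Sum>a<k. U a i * U a j)"
  have pW: "p \<in> ?W"
    using linear_closed_sum[OF col_space_linear_closed 0, of k U "\<lambda>a. U a i"] U(1)
    by (simp add: p_def k_def)
  have pz: "z i = inner_upto n p z" if z: "z \<in> ?W" for z
  proof -
    have "frame_residual n U k z i = 0"
    proof (rule ccontr)
      assume "\<not> ?thesis"
      then have "has_frame n ?W (Suc k)"
        using has_frame_extend[OF col_space_linear_closed, of k U n r M n z i] U z i by (simp add: k_def)
      then show False using frame_dim_props(2)[of ?W n r M "Suc k"] by (simp add: k_def)
    qed
    then have "z i = (\<Sum>a<k. U a i * inner_upto n (U a) z)"
      unfolding frame_residual_def by (simp add: inner_upto_commute mult.commute)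
    then show ?thesis unfolding p_def inner_upto_sum_left .
  qed
  have orth: "(\<Sum>j<n. ((if j = i then 1 else 0) - q j) * z j) = z i - inner_upto n q z" for q z :: "nat \<Rightarrow> real"
  proof -
    have "(\<Sum>j<n. ((if j = i then 1 else 0) - q j) * z j)
        = (\<Sum>j<n. (if j = i then z j else 0) - q j * z j)"
      by (rule sum.cong) (auto simp: algebra_simps)
    then show ?thesis using i by (simp add: sum_subtractf inner_upto_def)
  qed
  have sq: "(\<Sum>j<n. (q j)\<^sup>2) = inner_upto n q q" for q
    by (simp add: inner_upto_def power2_eq_square)
  have "proj_sq_norm n r M i = inner_upto n p p"
    unfolding proj_sq_norm_def
  proof (rule the_equality)
    show "\<exists>q\<in>?W. (\<forall>z\<in>?W. (\<Sum>j<n. ((if j = i then 1 else 0) - q j) * z j) = 0)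
        \<and> inner_upto n p p = (\<Sum>j<n. (q j)\<^sup>2)"
      using pW pz by (intro bexI[of _ p]) (auto simp: orth sq)
  next
    fix x assume "\<exists>q\<in>?W. (\<forall>z\<in>?W. (\<Sum>j<n. ((if j = i then 1 else 0) - q j) * z j) = 0)
        \<and> x = (\<Sum>j<n. (q j)\<^sup>2)"
    then obtain q where q: "q \<in> ?W" "\<forall>z\<in>?W. z i = inner_upto n q z" "x = inner_upto n q q"
      by (auto simp: orth sq)
    have "inner_upto n q q = q i" using q by auto
    moreover have "q i = inner_upto n p q" using pz q by auto
    moreover have "inner_upto n p q = p i" using q pW by (metis inner_upto_commute)
    moreover have "p i = inner_upto n p p" using pz pW by auto
    ultimately show "x = inner_upto n p p" using q by simp
  qed
  then show ?thesis using pW pz by blast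
qed

text \<open>By the reproducing property U_a(i) = <p, U_a>, so the mass of the frame in row
  \<open>i\<close> is a Bessel sum for the projection p of e_i.\<close>

lemma frame_leverage_le:
  assumes "\<And>a. a < k \<Longrightarrow> U a \<in> col_space n r M" "orthonormal_upto n U k" "i < n"
  shows "(\<Sum>a<k. (U a i)\<^sup>2) \<le> proj_sq_norm n r M i"
proof -
  obtain p where p: "\<forall>z\<in>col_space n r M. z i = inner_upto n p z"
    "proj_sq_norm n r M i = inner_upto n p p"
    using proj_sq_norm_witness[OF assms(3), of r M] by blast
  have "(\<Sum>a<k. (U a i)\<^sup>2) = (\<Sum>a<k. (inner_upto n p (U a))\<^sup>2)"
    using p assms(1) by (intro sum.cong) auto
  then show ?thesis using bessel[OF assms(2)] p by simp
qed

text \<open>The total mass \<open>k\<close> of the frame lies in the rows on which \<open>V\<close>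
  is not identically zero, and each row holds at most \<open>q\<close> of it.\<close>

lemma frame_support_ge:
  assumes "\<And>a. a < k \<Longrightarrow> U a \<in> V" "V \<subseteq> col_space n r M" "orthonormal_upto n U k"
    and q: "\<And>i. i < n \<Longrightarrow> proj_sq_norm n r M i \<le> q"
  shows "real k \<le> q * real (card {i. i < n \<and> (\<exists>v\<in>V. v i \<noteq> 0)})"
proof -
  let ?A = "{i. i < n \<and> (\<exists>v\<in>V. v i \<noteq> 0)}"
  have "real k = (\<Sum>a<k. inner_upto n (U a) (U a))"
    using assms(3) by (simp add: orthonormal_upto_def)
  also have "\<dots> = (\<Sum>i<n. \<Sum>a<k. (U a i)\<^sup>2)"
    unfolding inner_upto_def by (subst sum.swap) (simp add: power2_eq_square)
  also have "\<dots> = (\<Sum>i\<in>?A. \<Sum>a<k. (U a i)\<^sup>2)"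
  proof (rule sum.mono_neutral_right)
    show "\<forall>i\<in>{..<n} - ?A. (\<Sum>a<k. (U a i)\<^sup>2) = 0"
    proof
      fix i assume "i \<in> {..<n} - ?A"
      then have "U a i = 0" if "a < k" for a using assms(1)[OF that] by auto
      then show "(\<Sum>a<k. (U a i)\<^sup>2) = 0" by simp
    qed
  qed auto
  also have "\<dots> \<le> (\<Sum>i\<in>?A. q)"
  proof (rule sum_mono)
    fix i assume "i \<in> ?A"
    then show "(\<Sum>a<k. (U a i)\<^sup>2) \<le> q"
      using frame_leverage_le[of k U n r M i] assms(1-3) q[of i] by fastforce
  qed
  finally show ?thesis by (simp add: mult.commute)
qed

section \<open>Random row sets\<close>

definition vanishing_on :: "(nat \<Rightarrow> real) set \<Rightarrow> nat set \<Rightarrow> (nat \<Rightarrow> real) set" where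
  "vanishing_on W L = {v\<in>W. \<forall>i\<in>L. v i = 0}"

definition k_subsets :: "nat \<Rightarrow> nat \<Rightarrow> nat set set" where
  "k_subsets n k = {L. L \<subseteq> {..<n} \<and> card L = k}"

text \<open>This is the f(Lambda) of the overview.\<close>

definition residual_dim :: "nat \<Rightarrow> nat \<Rightarrow> mat \<Rightarrow> nat set \<Rightarrow> nat" where
  "residual_dim n r M L = frame_dim n (vanishing_on (col_space n r M) L)"

lemma vanishing_on_subset: "vanishing_on W L \<subseteq> W"
  by (auto simp: vanishing_on_def)

lemma vanishing_on_linear_closed: "linear_closed W \<Longrightarrow> linear_closed (vanishing_on W L)"
  by (auto simp: vanishing_on_def linear_closed_def)

lemma finite_k_subsets: "finite (k_subsets n k)"
  unfolding k_subsets_def by (rule finite_subset[of _ "Pow {..<n}"]) auto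

lemma card_k_subsets: "card (k_subsets n k) = n choose k"
  using n_subsets[of "{..<n}" k] by (simp add: k_subsets_def)

lemma residual_dim_insert_le: "residual_dim n r M (insert a L) \<le> residual_dim n r M L"
proof -
  have "has_frame n (vanishing_on (col_space n r M) L) (residual_dim n r M (insert a L))"
    unfolding residual_dim_def
    by (rule has_frame_mono[OF frame_dim_props(1)[OF vanishing_on_subset]])
      (auto simp: vanishing_on_def)
  then show ?thesis
    unfolding residual_dim_def[of n r M L] by (rule frame_dim_props(2)[OF vanishing_on_subset])
qed

text \<open>A frame of the smaller space vanishes at \<open>a\<close>, so the residual of
  \<open>v\<close> at \<open>a\<close> is \<open>v a\<close> itself, and \<open>v\<close> extends
  the frame inside the larger space.\<close>

lemma residual_dim_insert_active:
  assumes "a < n" "v \<in> vanishing_on (col_space n r M) L" "v a \<noteq> 0"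
  shows "Suc (residual_dim n r M (insert a L)) \<le> residual_dim n r M L"
proof -
  let ?V = "vanishing_on (col_space n r M) L" and ?V' = "vanishing_on (col_space n r M) (insert a L)"
  define k where "k = residual_dim n r M (insert a L)"
  have "has_frame n ?V' k"
    unfolding k_def residual_dim_def by (rule frame_dim_props(1)[OF vanishing_on_subset])
  then obtain U where U: "\<And>b. b < k \<Longrightarrow> U b \<in> ?V'" "orthonormal_upto n U k"
    unfolding has_frame_def by blast
  have "U b a = 0" if "b < k" for b using U(1)[OF that] by (simp add: vanishing_on_def)
  then have nz: "frame_residual n U k v a \<noteq> 0" using assms(3) by (simp add: frame_residual_def)
  have "U b \<in> ?V" if "b < k" for b using U(1)[OF that] by (simp add: vanishing_on_def)
  then have "has_frame n ?V (Suc k)"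
    using has_frame_extend[OF vanishing_on_linear_closed[OF col_space_linear_closed] _ U(2) assms(2,1) nz]
    by blast
  then show ?thesis
    unfolding residual_dim_def[of n r M L] k_def[symmetric]
    by (rule frame_dim_props(2)[OF vanishing_on_subset])
qed

text \<open>At least f(L)/q of the rows outside \<open>L\<close> are active, and each of them lowers
  f by at least one. The bound \<open>q\<close> is later \<open>\<mu>\<close> r / n, which makes the
  contraction factor 1 - 1/(\<open>\<mu>\<close> r).\<close>

lemma residual_dim_insert_sum_le:
  assumes q: "0 < q" "\<And>i. i < n \<Longrightarrow> proj_sq_norm n r M i \<le> q" and L: "L \<subseteq> {..<n}" and n: "0 < n"
  shows "(\<Sum>a\<in>{..<n} - L. real (residual_dim n r M (insert a L)))
    \<le> real (n - card L) * (1 - 1 / (q * real n)) * real (residual_dim n r M L)"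
proof -
  let ?f = "residual_dim n r M" and ?V = "vanishing_on (col_space n r M) L"
  let ?A = "{i. i < n \<and> (\<exists>v\<in>?V. v i \<noteq> 0)}"
  have cL: "card ({..<n} - L) = n - card L" using L by (simp add: card_Diff_subset finite_subset)
  have AL: "?A \<subseteq> {..<n} - L" by (auto simp: vanishing_on_def)
  have step: "real (?f (insert a L)) \<le> real (?f L) - (if a \<in> ?A then 1 else 0)"
    if "a \<in> {..<n} - L" for a
  proof (cases "a \<in> ?A")
    case True
    then obtain v where "v \<in> ?V" "v a \<noteq> 0" by auto
    then have "Suc (?f (insert a L)) \<le> ?f L"
      using residual_dim_insert_active[of a n v r M L] True by auto
    then show ?thesis using True by simp
  next
    case False
    then show ?thesis using residual_dim_insert_le[of n r M a L] by auto
  qed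
  have "has_frame n ?V (?f L)"
    unfolding residual_dim_def by (rule frame_dim_props(1)[OF vanishing_on_subset])
  then obtain U where U: "\<And>b. b < ?f L \<Longrightarrow> U b \<in> ?V" "orthonormal_upto n U (?f L)"
    unfolding has_frame_def by blast
  have "real (?f L) \<le> q * real (card ?A)"
    using frame_support_ge[OF U(1) vanishing_on_subset U(2) q(2)] by blast
  then have A: "real (?f L) / q \<le> real (card ?A)"
    using q(1) by (simp add: divide_le_eq mult.commute)
  have "(\<Sum>a\<in>{..<n} - L. real (?f (insert a L)))
      \<le> (\<Sum>a\<in>{..<n} - L. real (?f L) - (if a \<in> ?A then 1 else 0))"
    by (intro sum_mono step)
  also have "\<dots> = real (n - card L) * real (?f L) - real (card ?A)"
  proof -
    have "(\<Sum>a\<in>{..<n} - L. if a \<in> ?A then 1 else 0) = real (card ?A)"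
    proof -
      have "(\<Sum>a\<in>{..<n} - L. if a \<in> ?A then 1 else 0) = (\<Sum>a\<in>({..<n} - L) \<inter> ?A. 1 :: real)"
        by (rule sum.inter_restrict[symmetric]) simp
      also have "({..<n} - L) \<inter> ?A = ?A" using AL by blast
      finally show ?thesis by simp
    qed
    then show ?thesis by (simp only: sum_subtractf sum_constant cL)
  qed
  also have "\<dots> \<le> real (n - card L) * real (?f L) - real (?f L) / q" using A by simp
  \<comment> \<open>The gain f(L)/q is weakened by the factor (n - |L|)/n \<le> 1, so that the
    contraction factor does not depend on the size of \<open>L\<close>.\<close>
  also have "\<dots> \<le> real (n - card L) * real (?f L) - real (n - card L) / real n * (real (?f L) / q)"
  proof -
    have "real (n - card L) / real n \<le> 1" using n by simp
    then have "real (n - card L) / real n * (real (?f L) / q) \<le> 1 * (real (?f L) / q)"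
      using q(1) by (intro mult_right_mono) auto
    then show ?thesis by simp
  qed
  also have "\<dots> = real (n - card L) * (1 - 1 / (q * real n)) * real (?f L)"
    using q n by (simp add: field_simps)
  finally show ?thesis .
qed

text \<open>Double counting of pairs of a (k+1)-set and a marked element; deleting the marked
  element is the bijection. This takes the place of conditioning for draws without
  replacement.\<close>

lemma k_subsets_Suc_sum:
  fixes f :: "nat set \<Rightarrow> real"
  shows "real (Suc k) * (\<Sum>L\<in>k_subsets n (Suc k). f L)
    = (\<Sum>L\<in>k_subsets n k. \<Sum>a\<in>{..<n} - L. f (insert a L))"
proof -
  have fin: "finite L" if "L \<in> k_subsets n j" for L j
    using that finite_subset by (auto simp: k_subsets_def)
  have "real (Suc k) * (\<Sum>L\<in>k_subsets n (Suc k). f L) = (\<Sum>L\<in>k_subsets n (Suc k). \<Sum>a\<in>L. f L)"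
    unfolding sum_distrib_left by (rule sum.cong) (auto simp: k_subsets_def)
  also have "\<dots> = (\<Sum>(L, a)\<in>Sigma (k_subsets n (Suc k)) (\<lambda>L. L). f L)"
    by (rule sum.Sigma) (use finite_k_subsets fin in auto)
  also have "\<dots> = (\<Sum>(L, a)\<in>Sigma (k_subsets n k) (\<lambda>L. {..<n} - L). f (insert a L))"
    by (rule sum.reindex_bij_witness[where i = "\<lambda>(L, a). (insert a L, a)" and j = "\<lambda>(L, a). (L - {a}, a)"])
      (auto simp: k_subsets_def insert_absorb card_Diff_singleton finite_subset)
  also have "\<dots> = (\<Sum>L\<in>k_subsets n k. \<Sum>a\<in>{..<n} - L. f (insert a L))"
    by (rule sum.Sigma[symmetric]) (use finite_k_subsets in auto)
  finally show ?thesis .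
qed

text \<open>The average of f starts at no more than \<open>r\<close> and contracts by 1 - 1/(q n)
  \<le> exp(-1/(q n)) with each added row. It is kept as an unnormalised sum over subsets.\<close>

lemma residual_dim_sum_le:
  assumes q: "0 < q" "\<And>i. i < n \<Longrightarrow> proj_sq_norm n r M i \<le> q" and n: "0 < n" and "k \<le> n"
  shows "(\<Sum>L\<in>k_subsets n k. real (residual_dim n r M L))
    \<le> real (n choose k) * real r * exp (- real k / (q * real n))"
  using \<open>k \<le> n\<close>
proof (induction k)
  case 0
  have "k_subsets n 0 = {{}}"
    by (auto simp: k_subsets_def finite_subset)
  moreover have "residual_dim n r M {} \<le> r"
    unfolding residual_dim_def by (rule frame_dim_props(3)[OF vanishing_on_subset])
  ultimately show ?case by simp
next
  case (Suc k)
  let ?f = "\<lambda>L. real (residual_dim n r M L)" and ?F = "\<lambda>k. \<Sum>L\<in>k_subsets n k. real (residual_dim n r M L)"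
  let ?e = "1 / (q * real n)"
  have F0: "0 \<le> ?F k" by (intro sum_nonneg) auto
  have "real (Suc k) * ?F (Suc k) = (\<Sum>L\<in>k_subsets n k. \<Sum>a\<in>{..<n} - L. ?f (insert a L))"
    by (rule k_subsets_Suc_sum)
  also have "\<dots> \<le> (\<Sum>L\<in>k_subsets n k. real (n - k) * (1 - ?e) * ?f L)"
  proof (rule sum_mono)
    fix L assume "L \<in> k_subsets n k"
    then show "(\<Sum>a\<in>{..<n} - L. ?f (insert a L)) \<le> real (n - k) * (1 - ?e) * ?f L"
      using residual_dim_insert_sum_le[OF q, of L] n by (auto simp: k_subsets_def)
  qed
  also have "\<dots> = real (n - k) * ((1 - ?e) * ?F k)" by (simp add: sum_distrib_left mult_ac)
  also have "\<dots> \<le> real (n - k) * (exp (- ?e) * ?F k)"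
    using F0 exp_ge_add_one_self[of "- ?e"] by (intro mult_left_mono mult_right_mono) auto
  also have "\<dots> \<le> real (n - k) * (exp (- ?e) * (real (n choose k) * real r * exp (- real k / (q * real n))))"
    using Suc by (intro mult_left_mono) auto
  also have "\<dots> = (real (n - k) * real (n choose k)) * real r * (exp (- ?e) * exp (- real k / (q * real n)))"
    by (simp add: mult_ac)
  also have "exp (- ?e) * exp (- real k / (q * real n)) = exp (- real (Suc k) / (q * real n))"
    by (simp add: exp_add[symmetric] add_divide_distrib diff_divide_distrib)
  \<comment> \<open>Absorption passes from the number of k-subsets to that of (k+1)-subsets, the
    normalisation of the next average.\<close>
  also have "real (n - k) * real (n choose k) = real (Suc k) * real (n choose Suc k)"
    using binomial_absorb_comp[of n k] binomial_absorption[of k n] by (simp only: of_nat_mult[symmetric])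
  finally have "real (Suc k) * ?F (Suc k)
     \<le> real (Suc k) * (real (n choose Suc k) * real r * exp (- real (Suc k) / (q * real n)))"
    by (simp only: mult.assoc)
  then show ?case by (rule mult_left_le_imp_le) simp
qed

definition unresolving_sets :: "nat \<Rightarrow> nat \<Rightarrow> mat \<Rightarrow> nat \<Rightarrow> nat set set" where
  "unresolving_sets n r M w = {L\<in>k_subsets n w. residual_dim n r M L \<noteq> 0}"

lemma resolving_imp_zero:
  assumes "L \<in> k_subsets n w - unresolving_sets n r M w" "v \<in> col_space n r M"
    "\<And>a. a \<in> L \<Longrightarrow> v a = 0" "a < n"
  shows "v a = 0"
proof (rule frame_dim_0_imp[OF vanishing_on_subset])
  show "linear_closed (vanishing_on (col_space n r M) L)"
    by (intro vanishing_on_linear_closed col_space_linear_closed)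
  show "frame_dim n (vanishing_on (col_space n r M) L) = 0"
    using assms(1) by (auto simp: unresolving_sets_def residual_dim_def)
qed (use assms in \<open>auto simp: vanishing_on_def\<close>)

text \<open>No unit vector vanishes in all \<open>n\<close> coordinates. This covers the case in
  which the minimum in \<open>amc_rows\<close> is the number of rows.\<close>

lemma residual_dim_full: "residual_dim n r M {..<n} = 0"
proof (rule ccontr)
  let ?V = "vanishing_on (col_space n r M) {..<n}"
  assume nz: "\<not> ?thesis"
  have "has_frame n ?V (residual_dim n r M {..<n})"
    unfolding residual_dim_def by (rule frame_dim_props(1)[OF vanishing_on_subset])
  then obtain U where "U 0 \<in> ?V" "inner_upto n (U 0) (U 0) = 1"
    using nz unfolding has_frame_def orthonormal_upto_def by auto
  then show False by (simp add: vanishing_on_def inner_upto_def)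
qed

text \<open>Markov's inequality in counting form: f is a natural number, so the sets with f \<noteq>
  0 number at most the sum of f. The factor \<open>Suc r\<close> is the number of draws per slice
  that the union bound has to cover.\<close>

lemma card_unresolving_sets_le:
  assumes coh: "coherence n r M \<le> \<mu>" and pos: "0 < \<mu>" "2 \<le> r" "0 < n" "0 < \<delta>" "\<delta> < 1"
  defines "w \<equiv> amc_rows 3 \<mu> r \<delta> n"
  shows "real (Suc r) * real (card (unresolving_sets n r M w)) \<le> \<delta> * real (n choose w)"
\<comment> \<open>When the cap \<open>n\<close> is attained, \<open>w\<close> may be too small for
  the exponential bound; all rows are drawn then.\<close>
proof (cases "w = n")
  case True
  have "L = {..<n}" if "L \<in> k_subsets n n" for L
    using that card_subset_eq[of "{..<n}" L] by (auto simp: k_subsets_def)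
  then have "residual_dim n r M L = 0" if "L \<in> k_subsets n n" for L
    using that residual_dim_full[of n r M] by metis
  then have "unresolving_sets n r M w = {}"
    unfolding True unresolving_sets_def by auto
  then show ?thesis using pos by simp
next
  case False
  let ?x = "\<mu> * real r * ln (real r / \<delta>)" and ?B = "unresolving_sets n r M w"
  define q where "q = \<mu> * real r / real n"
  have q: "0 < q" using pos by (simp add: q_def)
  have proj: "proj_sq_norm n r M i \<le> q" if "i < n" for i
  proof -
    have "proj_sq_norm n r M i \<le> Max (proj_sq_norm n r M ` {..<n})" using that by simp
    also have "\<dots> \<le> q" using coh pos by (simp add: coherence_def q_def field_simps)
    finally show ?thesis .
  qed
  have wn: "w \<le> n" by (simp add: w_def amc_rows_def)
  have w3: "3 * ?x \<le> real w"
  proof -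
    have "w = nat \<lceil>3 * ?x\<rceil>" using False unfolding w_def amc_rows_def by (auto simp: min_def mult.assoc)
    then show ?thesis by (simp add: le_nat_iff real_nat_ceiling_ge)
  qed
  have lnpos: "real r / \<delta> > 0" using pos by simp
  have "real (card ?B) = (\<Sum>L\<in>?B. 1)" by simp
  also have "\<dots> \<le> (\<Sum>L\<in>?B. real (residual_dim n r M L))"
    by (rule sum_mono) (auto simp: unresolving_sets_def Suc_leI)
  also have "\<dots> \<le> (\<Sum>L\<in>k_subsets n w. real (residual_dim n r M L))"
    by (rule sum_mono2) (auto simp: unresolving_sets_def finite_k_subsets)
  also have "\<dots> \<le> real (n choose w) * real r * exp (- real w / (q * real n))"
    by (rule residual_dim_sum_le[OF q proj]) (use pos wn in auto)
  also have "exp (- real w / (q * real n)) \<le> exp (- 3 * ln (real r / \<delta>))"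
  proof -
    have "q * real n = \<mu> * real r" using pos by (simp add: q_def)
    moreover have "3 * ln (real r / \<delta>) \<le> real w / (\<mu> * real r)"
      using w3 assms by (simp add: pos_le_divide_eq mult_ac)
    ultimately show ?thesis by simp
  qed
  also have "exp (- 3 * ln (real r / \<delta>)) = (\<delta> / real r) ^ 3"
  proof -
    have "exp (- 3 * ln (real r / \<delta>)) = exp (real 3 * - ln (real r / \<delta>))" by simp
    also have "\<dots> = exp (- ln (real r / \<delta>)) ^ 3" by (rule exp_of_nat_mult)
    also have "exp (- ln (real r / \<delta>)) = \<delta> / real r" using lnpos by (simp add: exp_minus)
    finally show ?thesis .
  qed
  finally have B: "real (card ?B) \<le> real (n choose w) * real r * (\<delta> / real r) ^ 3"
    by (simp add: mult_left_mono)
  have "real (Suc r) * real (card ?B) \<le> real (Suc r) * (real (n choose w) * real r * (\<delta> / real r) ^ 3)"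
    using B by (intro mult_left_mono) auto
  also have "\<dots> = real (n choose w) * \<delta> * (real (Suc r) / (real r)\<^sup>2 * \<delta>\<^sup>2)"
    using pos by (simp add: field_simps power2_eq_square power3_eq_cube)
  \<comment> \<open>One power of 1/r in (\<delta>/r)^3 has cancelled the dimension bound
    \<open>r\<close>; the other two absorb the number of draws, since r + 1 \<le> r^2 for r \<ge>
    2.\<close>
  also have "\<dots> \<le> real (n choose w) * \<delta> * (1 * 1)"
  proof (intro mult_left_mono mult_mono)
    have "Suc r \<le> r * r" using pos(2) by (cases r) (auto simp: numeral_2_eq_2 dest: Suc_le_D)
    then have "real (Suc r) \<le> (real r)\<^sup>2" by (metis of_nat_le_iff of_nat_mult power2_eq_square)
    then show "real (Suc r) / (real r)\<^sup>2 \<le> 1" using pos by (simp add: divide_le_eq)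
    show "\<delta>\<^sup>2 \<le> 1" using pos by (simp add: power_le_one)
  qed (use pos in auto)
  finally show ?thesis by (simp add: mult.commute)
qed

section \<open>Tapes of independent uniform draws\<close>

lemma amc_tapes_iff:
  "f \<in> amc_tapes S n1 n2 w \<longleftrightarrow>
     (\<forall>i t. (i \<in> S \<and> t \<le> n2 \<longrightarrow> f i t \<in> k_subsets n1 w) \<and> (\<not> (i \<in> S \<and> t \<le> n2) \<longrightarrow> f i t = {}))"
  unfolding amc_tapes_def k_subsets_def by (simp add: if_split)

lemma amc_tapesD: "f \<in> amc_tapes S n1 n2 w \<Longrightarrow> i \<in> S \<Longrightarrow> t \<le> n2 \<Longrightarrow> f i t \<in> k_subsets n1 w"
  by (simp add: amc_tapes_iff)

text \<open>Finite because a tape has the fixed value \<open>{}\<close> outside its index range; the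
  uniform distribution \<open>pmf_of_set\<close> relies on it.\<close>

lemma finite_amc_tapes:
  assumes "finite S"
  shows "finite (amc_tapes S n1 n2 w)"
proof -
  let ?G = "{g :: nat \<Rightarrow> nat set. \<forall>t. (t \<in> {..n2} \<longrightarrow> g t \<in> Pow {..<n1}) \<and> (t \<notin> {..n2} \<longrightarrow> g t = {})}"
  have "finite ?G" by (rule finite_set_of_finite_funs) auto
  then have "finite {f :: nat \<Rightarrow> nat \<Rightarrow> nat set. \<forall>i. (i \<in> S \<longrightarrow> f i \<in> ?G) \<and> (i \<notin> S \<longrightarrow> f i = (\<lambda>_. {}))}"
    by (rule finite_set_of_finite_funs[OF assms])
  then show ?thesis
  proof (rule rev_finite_subset, intro subsetI CollectI allI conjI impI)
    fix f i t assume f: "f \<in> amc_tapes S n1 n2 w"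
    show "f i t \<in> Pow {..<n1}" if "i \<in> S" "t \<in> {..n2}"
      using amc_tapesD[OF f, of i t] that by (simp add: k_subsets_def)
    show "f i t = {}" if "t \<notin> {..n2}" using f that by (simp add: amc_tapes_iff)
    show "f i = (\<lambda>_. {})" if "i \<notin> S" using f that by (auto simp: amc_tapes_iff)
  qed
qed

lemma amc_tapes_nonempty:
  assumes "w \<le> n1"
  shows "amc_tapes S n1 n2 w \<noteq> {}"
proof -
  have "(\<lambda>i t. if i \<in> S \<and> t \<le> n2 then {..<w} else {}) \<in> amc_tapes S n1 n2 w"
    using assms by (auto simp: amc_tapes_iff k_subsets_def)
  then show ?thesis by blast
qed

text \<open>Overwriting the draw (i, t) is a bijection between the tapes with draw X and those with draw Y.\<close>
lemma amc_tapes_marginal: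
  assumes "finite S" "i \<in> S" "t \<le> n2" "B \<subseteq> k_subsets n1 w"
  shows "card {f\<in>amc_tapes S n1 n2 w. f i t \<in> B} * (n1 choose w) = card B * card (amc_tapes S n1 n2 w)"
proof (cases "k_subsets n1 w = {}")
  case True
  then have "B = {}" "n1 choose w = 0" using assms card_k_subsets[of n1 w] by auto
  then show ?thesis by simp
next
  case False
  then obtain X0 where X0: "X0 \<in> k_subsets n1 w" by blast
  let ?T = "amc_tapes S n1 n2 w"
  let ?N = "card {f\<in>?T. f i t = X0}"
  have upd: "f(i := (f i)(t := Y)) \<in> ?T" if "f \<in> ?T" "Y \<in> k_subsets n1 w" for f Y
    using that assms(2,3) by (simp add: amc_tapes_iff)
  have fib: "card {f\<in>?T. f i t = X} = ?N" if X: "X \<in> k_subsets n1 w" for X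
  proof (rule bij_betw_same_card)
    show "bij_betw (\<lambda>f. f(i := (f i)(t := X0))) {f\<in>?T. f i t = X} {f\<in>?T. f i t = X0}"
      by (rule bij_betw_byWitness[where f' = "\<lambda>f. f(i := (f i)(t := X))"])
        (use upd X X0 in auto)
  qed
  have tot: "card {f\<in>?T. f i t \<in> A} = card A * ?N" if A: "A \<subseteq> k_subsets n1 w" for A
  proof -
    have fA: "finite A" using A finite_k_subsets finite_subset by blast
    have "{f\<in>?T. f i t \<in> A} = (\<Union>X\<in>A. {f\<in>?T. f i t = X})" by auto
    also have "card \<dots> = (\<Sum>X\<in>A. card {f\<in>?T. f i t = X})"
      by (rule card_UN_disjoint) (use fA finite_amc_tapes[OF assms(1)] in auto)
    also have "\<dots> = (\<Sum>X\<in>A. ?N)" using A fib by (intro sum.cong) auto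
    finally show ?thesis by simp
  qed
  have "{f\<in>?T. f i t \<in> k_subsets n1 w} = ?T"
  proof -
    have "f i t \<in> k_subsets n1 w" if "f \<in> ?T" for f
      using amc_tapesD[OF that assms(2,3)] .
    then show ?thesis by blast
  qed
  then have "card ?T = (n1 choose w) * ?N" using tot[of "k_subsets n1 w"] by (simp add: card_k_subsets)
  then show ?thesis using tot[OF assms(4)] by simp
qed

text \<open>At most \<open>r\<close> columns are ever appended in a slice, and each appending moves
  on to the next draw, so the draws in use have the \<open>r + 1\<close> indices 0 to
  \<open>r\<close>. The condition mentions the tape only, not the run of the algorithm.\<close>

definition good_tapes :: "nat set \<Rightarrow> nat \<Rightarrow> nat \<Rightarrow> nat \<Rightarrow> nat \<Rightarrow> mat \<Rightarrow> (nat \<Rightarrow> nat \<Rightarrow> nat set) set" where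
  "good_tapes S n1 n2 w r M =
     {f\<in>amc_tapes S n1 n2 w. \<forall>i\<in>S. \<forall>t\<le>r. f i t \<notin> unresolving_sets n1 r M w}"

text \<open>Union bound over the \<open>card S * Suc r\<close> pairs of a slice and a draw, each
  harmful with probability at most \<delta>/(r + 1), because a single draw of a uniform tape is
  uniform. \<open>r \<le> n2\<close> keeps these draws within the tape.\<close>

lemma prob_good_tapes_ge:
  assumes "coherence n1 r M \<le> \<mu>" "0 < \<mu>" "2 \<le> r" "0 < n1" "0 < \<delta>" "\<delta> < 1"
    and S: "finite S" and "r \<le> n2"
  defines "w \<equiv> amc_rows 3 \<mu> r \<delta> n1"
  shows "1 - real (card S) * \<delta>
    \<le> measure (measure_pmf (pmf_of_set (amc_tapes S n1 n2 w))) (good_tapes S n1 n2 w r M)"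
proof -
  let ?T = "amc_tapes S n1 n2 w" and ?G = "good_tapes S n1 n2 w r M" and ?U = "unresolving_sets n1 r M w"
  have wn: "w \<le> n1" by (simp add: w_def amc_rows_def)
  have fT: "finite ?T" "?T \<noteq> {}" using finite_amc_tapes[OF S] amc_tapes_nonempty[OF wn] by auto
  have pos: "real (n1 choose w) > 0" using wn by (simp add: zero_less_binomial)
  have one: "real (Suc r) * real (card {f\<in>?T. f i t \<in> ?U}) \<le> \<delta> * real (card ?T)"
    if "i \<in> S" "t \<le> r" for i t
  proof -
    have "card {f\<in>?T. f i t \<in> ?U} * (n1 choose w) = card ?U * card ?T"
      by (rule amc_tapes_marginal) (use that S assms in \<open>auto simp: unresolving_sets_def\<close>)
    then have "real (Suc r) * real (card {f\<in>?T. f i t \<in> ?U}) * real (n1 choose w)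
        = real (Suc r) * real (card ?U) * real (card ?T)"
      by (metis (no_types) mult.assoc of_nat_mult)
    also have "\<dots> \<le> \<delta> * real (n1 choose w) * real (card ?T)"
      using card_unresolving_sets_le[OF assms(1-6)] unfolding w_def by (intro mult_right_mono) auto
    finally show ?thesis using pos by (simp add: mult_ac)
  qed
  let ?D = "\<lambda>p. {f\<in>?T. f (fst p) (snd p) \<in> ?U}"
  have sub: "?T - ?G \<subseteq> (\<Union>p\<in>S \<times> {..r}. ?D p)"
    by (auto simp: good_tapes_def)
  have "card (?T - ?G) \<le> card (\<Union>p\<in>S \<times> {..r}. ?D p)"
    by (rule card_mono[OF _ sub]) (use S fT in auto)
  also have "\<dots> \<le> (\<Sum>p\<in>S \<times> {..r}. card (?D p))"
    by (rule card_UN_le) (use S in auto)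
  finally have "real (card (?T - ?G)) \<le> real (\<Sum>p\<in>S \<times> {..r}. card (?D p))"
    by (simp only: of_nat_le_iff)
  also have "\<dots> = (\<Sum>p\<in>S \<times> {..r}. real (card (?D p)))" by (rule of_nat_sum)
  also have "\<dots> \<le> (\<Sum>p\<in>S \<times> {..r}. \<delta> * real (card ?T) / real (Suc r))"
  proof (rule sum_mono)
    fix p assume "p \<in> S \<times> {..r}"
    then have "real (Suc r) * real (card (?D p)) \<le> \<delta> * real (card ?T)"
      using one[of "fst p" "snd p"] by auto
    then show "real (card (?D p)) \<le> \<delta> * real (card ?T) / real (Suc r)"
      by (simp add: pos_le_divide_eq mult.commute)
  qed
  also have "\<dots> = real (card S) * \<delta> * real (card ?T)"
  proof -
    have "real (card (S \<times> {..r})) = real (card S) * real (Suc r)"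
      by (simp only: card_cartesian_product card_atMost of_nat_mult)
    then show ?thesis by (simp only: sum_constant) (simp del: of_nat_Suc)
  qed
  finally have bad: "real (card (?T - ?G)) \<le> real (card S) * \<delta> * real (card ?T)" .
  have GT: "?G \<subseteq> ?T" by (auto simp: good_tapes_def)
  have c: "real (card ?T) > 0" using fT by (simp add: card_gt_0_iff)
  have "real (card ?G) = real (card ?T) - real (card (?T - ?G))"
    using GT fT card_mono[OF fT(1) GT] by (simp add: card_Diff_subset finite_subset of_nat_diff)
  then have "real (card ?G) \<ge> (1 - real (card S) * \<delta>) * real (card ?T)"
    using bad by (simp add: algebra_simps)
  then show ?thesis using GT c fT by (simp add: measure_pmf_of_set Int_absorb1 pos_le_divide_eq)
qed

section \<open>Adaptive matrix completion\<close>

text \<open>What a good tape provides for one slice, free of probability: M = A c^T, and a vector of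
  the column space of \<open>A\<close> is determined by its entries on any of the row sets with
  index up to \<open>r\<close>.\<close>

locale amc_low_rank =
  fixes n1 n2 r w :: nat and A c M :: mat and Lams :: "nat \<Rightarrow> nat set"
  assumes rep: "\<And>a i. a < n1 \<Longrightarrow> i < n2 \<Longrightarrow> M a i = (\<Sum>l<r. A a l * c i l)"
    and Lams: "\<And>t. t \<le> r \<Longrightarrow> Lams t \<in> k_subsets n1 w"
    and res: "\<And>t y a. t \<le> r \<Longrightarrow> (\<And>b. b \<in> Lams t \<Longrightarrow> (\<Sum>l<r. A b l * y l) = 0) \<Longrightarrow> a < n1
                \<Longrightarrow> (\<Sum>l<r. A a l * y l) = 0"
begin

lemma combination_rep:
  assumes "J \<subseteq> {..<n2}" "a < n1"
  shows "(\<Sum>j\<in>J. M a j * y j) = (\<Sum>l<r. A a l * (\<Sum>j\<in>J. c j l * y j))"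
proof -
  have "(\<Sum>j\<in>J. M a j * y j) = (\<Sum>j\<in>J. \<Sum>l<r. A a l * (c j l * y j))"
    using assms rep by (intro sum.cong) (auto simp: sum_distrib_right mult.assoc)
  also have "\<dots> = (\<Sum>l<r. A a l * (\<Sum>j\<in>J. c j l * y j))"
    by (subst sum.swap) (simp add: sum_distrib_left)
  finally show ?thesis .
qed

text \<open>Combinations of columns of \<open>M\<close> lie in the column space of \<open>A\<close>,
  so a linear relation seen on the drawn rows holds on all rows. Exactness of the reconstruction and
  uniqueness of its coefficients both rest on this.\<close>

lemma combination_zero:
  assumes "t \<le> r" "J \<subseteq> {..<n2}" "\<And>a. a \<in> Lams t \<Longrightarrow> (\<Sum>j\<in>J. M a j * y j) = 0" "a < n1"
  shows "(\<Sum>j\<in>J. M a j * y j) = 0"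
  unfolding combination_rep[OF assms(2,4)]
proof (rule res[OF assms(1) _ assms(4)])
  fix b assume b: "b \<in> Lams t"
  then have "b < n1" using Lams[OF assms(1)] by (auto simp: k_subsets_def)
  then show "(\<Sum>l<r. A b l * (\<Sum>j\<in>J. c j l * y j)) = 0"
    using combination_rep[OF assms(2), of b y] assms(3)[OF b] by simp
qed

text \<open>The coefficient vectors live in R^r. The bound keeps the draw counter, which equals the
  number of appended columns, on the draws known to be harmless.\<close>

lemma indep_cols_card_le:
  assumes "indep_cols {..<n1} M J" "J \<subseteq> {..<n2}"
  shows "card J \<le> r"
proof (rule ccontr)
  assume "\<not> card J \<le> r"
  moreover have "finite J" using assms(2) finite_subset by blast
  ultimately obtain y where y: "\<exists>j\<in>J. y j \<noteq> 0" "\<forall>l\<in>{..<r}. (\<Sum>j\<in>J. c j l * y j) = 0"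
    using underdetermined[of "{..<r}" J "\<lambda>l j. c j l"] by auto
  have "\<forall>a\<in>{..<n1}. (\<Sum>j\<in>J. M a j * y j) = 0"
    using combination_rep[OF assms(2), of _ y] y(2) by simp
  then show False using assms(1) y(1) unfolding indep_cols_def by blast
qed

text \<open>Two solutions differ by a relation on the drawn rows, hence on all rows, and that
  relation is trivial since the columns are independent. With a single solution the norm has nothing
  to be compared with, and the definite description is determined.\<close>

lemma min_norm_coeffs_unique:
  assumes J: "set J \<subseteq> {..<n2}" "indep_cols {..<n1} M (set J)" and t: "t \<le> r"
    and z: "\<forall>j. j \<notin> set J \<longrightarrow> z j = 0" "\<forall>a\<in>Lams t. (\<Sum>j\<in>set J. M a j * z j) = M a i"
  shows "min_norm_coeffs M J (Lams t) i = z"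
proof -
  have uniq: "z' = z" if z': "\<forall>j. j \<notin> set J \<longrightarrow> z' j = 0"
    "\<forall>a\<in>Lams t. (\<Sum>j\<in>set J. M a j * z' j) = M a i" for z'
  proof -
    have "(\<Sum>j\<in>set J. M a j * (z' j - z j)) = 0" if "a < n1" for a
      by (rule combination_zero[OF t J(1) _ that])
        (use z z' in \<open>simp add: right_diff_distrib sum_subtractf\<close>)
    then have eq: "\<forall>j\<in>set J. z' j - z j = 0"
      using J(2) unfolding indep_cols_def by (auto dest: spec[of _ "\<lambda>j. z' j - z j"])
    show ?thesis
    proof
      fix j show "z' j = z j" using eq z(1) z'(1) by (cases "j \<in> set J") auto
    qed
  qed
  show ?thesis
    unfolding min_norm_coeffs_def
  proof (rule the_equality)
    let ?sol = "\<lambda>z'. (\<forall>j. j \<notin> set J \<longrightarrow> z' j = 0) \<and> (\<forall>a\<in>Lams t. (\<Sum>j\<in>set J. M a j * z' j) = M a i)"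
    have "(\<Sum>j\<in>set J. (z j)\<^sup>2) \<le> (\<Sum>j\<in>set J. (z' j)\<^sup>2)" if "?sol z'" for z'
      using uniq[of z'] that by simp
    then show "(\<forall>j. j \<notin> set J \<longrightarrow> z j = 0) \<and> (\<forall>a\<in>Lams t. (\<Sum>j\<in>set J. M a j * z j) = M a i) \<and>
        (\<forall>z'. ?sol z' \<longrightarrow> (\<Sum>j\<in>set J. (z j)\<^sup>2) \<le> (\<Sum>j\<in>set J. (z' j)\<^sup>2))"
      using z by blast
  next
    fix z'
    assume "(\<forall>j. j \<notin> set J \<longrightarrow> z' j = 0) \<and> (\<forall>a\<in>Lams t. (\<Sum>j\<in>set J. M a j * z' j) = M a i) \<and>
        (\<forall>z''. (\<forall>j. j \<notin> set J \<longrightarrow> z'' j = 0) \<and> (\<forall>a\<in>Lams t. (\<Sum>j\<in>set J. M a j * z'' j) = M a i)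
          \<longrightarrow> (\<Sum>j\<in>set J. (z' j)\<^sup>2) \<le> (\<Sum>j\<in>set J. (z'' j)\<^sup>2))"
    then show "z' = z" by (elim conjE) (rule uniq)
  qed
qed

text \<open>The count reflects that every column, even one observed in full, is first read on
  \<open>w\<close> rows; positions read twice are counted twice.\<close>

definition amc_invariant :: "nat \<Rightarrow> amc_state \<Rightarrow> bool" where
  "amc_invariant m st = (case st of (J, t, Mc, obs) \<Rightarrow>
     distinct J \<and> set J \<subseteq> {..<m} \<and> t = length J \<and> indep_cols {..<n1} M (set J) \<and>
     (\<forall>a<n1. \<forall>b<m. Mc a b = M a b) \<and> length obs = m * w + n1 * length J)"

lemma amc_step_invariant:
  assumes inv: "amc_invariant m st" and m: "m < n2"
  shows "amc_invariant (Suc m) (amc_step n1 M Lams m st)"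
proof -
  obtain J t Mc obs where st: "st = (J, t, Mc, obs)" by (cases st)
  have J: "distinct J" "set J \<subseteq> {..<m}" "t = length J" "indep_cols {..<n1} M (set J)"
    "\<forall>a<n1. \<forall>b<m. Mc a b = M a b" "length obs = m * w + n1 * length J"
    using inv by (auto simp: amc_invariant_def st)
  have J2: "set J \<subseteq> {..<n2}" using J(2) m by auto
  have mJ: "m \<notin> set J" using J(2) by auto
  have t: "t \<le> r" using indep_cols_card_le[OF J(4) J2] J(1,3) by (simp add: distinct_card)
  have L: "Lams t \<subseteq> {..<n1}" "card (Lams t) = w" using Lams[OF t] by (auto simp: k_subsets_def)
  have len: "length (sorted_list_of_set (Lams t)) = w" using L by simp
  show ?thesis
  proof (cases "\<exists>y. \<forall>a\<in>Lams t. M a m = (\<Sum>j\<in>set J. M a j * y j)")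
    case True
    then obtain y where y: "\<forall>a\<in>Lams t. M a m = (\<Sum>j\<in>set J. M a j * y j)" by blast
    \<comment> \<open>The extension by zero is what \<open>min_norm_coeffs\<close> prescribes
      outside the index set.\<close>
    define z where "z j = (if j \<in> set J then y j else 0)" for j
    have z: "(\<Sum>j\<in>set J. M a j * z j) = (\<Sum>j\<in>set J. M a j * y j)" for a
      by (rule sum.cong) (auto simp: z_def)
    have mn: "min_norm_coeffs M J (Lams t) m = z"
      by (rule min_norm_coeffs_unique[OF J2 J(4) t]) (use y in \<open>simp_all add: z\<close>, simp add: z_def)
    \<comment> \<open>With coefficient -1 at the new column, the representation on the drawn rows
      becomes a vanishing combination, to which \<open>combination_zero\<close> applies.\<close>
    have comb: "(\<Sum>j\<in>insert m (set J). M a j * (z(m := -1)) j) = (\<Sum>j\<in>set J. M a j * z j) - M a m" for a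
    proof -
      have "(\<Sum>j\<in>set J. M a j * (z(m := -1)) j) = (\<Sum>j\<in>set J. M a j * z j)"
        using mJ by (intro sum.cong) auto
      then show ?thesis using mJ by simp
    qed
    have rec: "M a m = (\<Sum>j\<in>set J. M a j * z j)" if "a < n1" for a
    proof -
      have "(\<Sum>j\<in>insert m (set J). M a j * (z(m := -1)) j) = 0"
        by (rule combination_zero[OF t _ _ that]) (use J2 m y in \<open>simp_all add: comb z del: sum.insert fun_upd_apply\<close>)
      then show ?thesis unfolding comb by simp
    qed
    have "amc_step n1 M Lams m st = (J, t, (\<lambda>a b. if b = m then (\<Sum>j\<in>set J. M a j * z j) else Mc a b),
        obs @ map (\<lambda>a. (a, m)) (sorted_list_of_set (Lams t)))"
      using True by (simp add: amc_step_def st Let_def mn cong: if_cong)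
    then show ?thesis
      using J len rec by (auto simp: amc_invariant_def less_Suc_eq)
  next
    case False
    \<comment> \<open>If the new column had a nonzero coefficient in a relation, it would be a
      combination of the kept ones on all rows, so the test on the drawn rows would have
      succeeded.\<close>
    have ind: "indep_cols {..<n1} M (insert m (set J))"
      unfolding indep_cols_def
    proof (intro allI impI)
      fix y assume y: "\<forall>a\<in>{..<n1}. (\<Sum>j\<in>insert m (set J). M a j * y j) = 0"
      have y': "M a m * y m + (\<Sum>j\<in>set J. M a j * y j) = 0" if "a < n1" for a
        using y that mJ by auto
      have "y m = 0"
      proof (rule ccontr)
        assume ym: "y m \<noteq> 0"
        have "M a m = (\<Sum>j\<in>set J. M a j * (- y j / y m))" if "a < n1" for a
        proof -
          have e: "(\<Sum>j\<in>set J. M a j * (- y j / y m)) = - (\<Sum>j\<in>set J. M a j * y j) / y m"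
            by (simp add: sum_divide_distrib sum_negf)
          show ?thesis unfolding e using y'[OF that] ym by (simp add: field_simps)
        qed
        then have "\<forall>a\<in>Lams t. M a m = (\<Sum>j\<in>set J. M a j * (- y j / y m))" using L by blast
        then show False using False by (elim notE) (rule exI)
      qed
      moreover have "\<forall>j\<in>set J. y j = 0"
        using J(4) y' \<open>y m = 0\<close> unfolding indep_cols_def by simp
      ultimately show "\<forall>j\<in>insert m (set J). y j = 0" by simp
    qed
    have "amc_step n1 M Lams m st = (J @ [m], Suc t, (\<lambda>a b. if b = m then M a m else Mc a b),
        obs @ map (\<lambda>a. (a, m)) (sorted_list_of_set (Lams t)) @ map (\<lambda>a. (a, m)) [0..<n1])"
      using False by (simp add: amc_step_def st Let_def)
    then show ?thesis
      using J len ind by (auto simp: amc_invariant_def less_Suc_eq)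
  qed
qed

lemma amc_fold_invariant:
  "m \<le> n2 \<Longrightarrow> amc_invariant m (fold (amc_step n1 M Lams) [0..<m] ([], 0, (\<lambda>_ _. 0), []))"
proof (induction m)
  case 0
  show ?case by (simp add: amc_invariant_def indep_cols_def)
next
  case (Suc m)
  then show ?case using amc_step_invariant[of m] by simp
qed

lemma amc_correct:
  shows "a < n1 \<Longrightarrow> b < n2 \<Longrightarrow> fst (snd (snd (amc n1 n2 M Lams))) a b = M a b"
    and "length (snd (snd (snd (amc n1 n2 M Lams)))) \<le> n2 * w + n1 * r"
proof -
  obtain J t Mc obs where st: "amc n1 n2 M Lams = (J, t, Mc, obs)" by (cases "amc n1 n2 M Lams")
  have inv: "amc_invariant n2 (J, t, Mc, obs)"
    using amc_fold_invariant[of n2] st by (simp add: amc_def)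
  then show "a < n1 \<Longrightarrow> b < n2 \<Longrightarrow> fst (snd (snd (amc n1 n2 M Lams))) a b = M a b"
    by (simp add: st amc_invariant_def)
  have "length J \<le> r"
    using inv indep_cols_card_le[of "set J"] by (simp add: amc_invariant_def distinct_card)
  then show "length (snd (snd (snd (amc n1 n2 M Lams)))) \<le> n2 * w + n1 * r"
    using inv by (simp add: st amc_invariant_def)
qed

end

section \<open>Gaussian mixtures\<close>

lemma prob_space_std_normal: "prob_space (density lborel std_normal_density)"
  by (rule prob_space_normal_density) simp

text \<open>Fubini in coordinate \<open>j\<close>: once the other coordinates are fixed, a single
  value of x_j solves the equation, and points are null for a measure with a density.\<close>

lemma gaussian_hyperplane_null:
  fixes a :: "nat \<Rightarrow> real"
  assumes j: "j < k" "a j \<noteq> 0"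
  shows "AE x in Pi\<^sub>M {..<k} (\<lambda>_. density lborel std_normal_density). (\<Sum>i<k. a i * x i) \<noteq> 0"
proof -
  let ?N = "density lborel std_normal_density"
  let ?I = "{..<k} - {j}"
  interpret N: prob_space ?N by (rule prob_space_std_normal)
  interpret product_sigma_finite "\<lambda>_ :: nat. ?N"
    by unfold_locales
  have ins: "insert j ?I = {..<k}" using j by auto
  have [measurable]: "(\<lambda>x. x i) \<in> borel_measurable (Pi\<^sub>M {..<k} (\<lambda>_. ?N))" if "i < k" for i
    using measurable_component_singleton[of i "{..<k}" "\<lambda>_. ?N"] that by simp
  define H where "H = {x\<in>space (Pi\<^sub>M {..<k} (\<lambda>_. ?N)). (\<Sum>i<k. a i * x i) = 0}"
  have H: "H \<in> sets (Pi\<^sub>M {..<k} (\<lambda>_. ?N))" unfolding H_def by measurable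
  have "emeasure (Pi\<^sub>M {..<k} (\<lambda>_. ?N)) H = (\<integral>\<^sup>+x. indicator H x \<partial>Pi\<^sub>M (insert j ?I) (\<lambda>_. ?N))"
    unfolding ins using H by simp
  also have "\<dots> = (\<integral>\<^sup>+x. (\<integral>\<^sup>+y. indicator H (x(j := y)) \<partial>?N) \<partial>Pi\<^sub>M ?I (\<lambda>_. ?N))"
  proof (rule product_nn_integral_insert)
    show "indicator H \<in> borel_measurable (Pi\<^sub>M (insert j ?I) (\<lambda>_. ?N))"
      unfolding ins using H by simp
  qed auto
  also have "\<dots> = (\<integral>\<^sup>+x. 0 \<partial>Pi\<^sub>M ?I (\<lambda>_. ?N))"
  proof (rule nn_integral_cong)
    fix x :: "nat \<Rightarrow> real"
    let ?p = "- (\<Sum>i\<in>?I. a i * x i) / a j"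
    have "indicator H (x(j := y)) \<le> (indicator {?p} y :: ennreal)" for y
    proof -
      have "(\<Sum>i<k. a i * (x(j := y)) i) = a j * y + (\<Sum>i\<in>?I. a i * x i)"
      proof -
        have "(\<Sum>i\<in>?I. a i * (x(j := y)) i) = (\<Sum>i\<in>?I. a i * x i)"
          by (rule sum.cong) auto
        then show ?thesis using j by (subst sum.remove[of _ j]) auto
      qed
      then have "y = ?p" if "x(j := y) \<in> H"
        using that j by (simp add: H_def field_simps)
      then show ?thesis by (auto simp: indicator_def)
    qed
    then have "(\<integral>\<^sup>+y. indicator H (x(j := y)) \<partial>?N) \<le> (\<integral>\<^sup>+y. indicator {?p} y \<partial>?N)"
      by (intro nn_integral_mono)
    also have "\<dots> = emeasure ?N {?p}" by simp
    also have "\<dots> = 0"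
    proof -
      have "absolutely_continuous lborel ?N" by (rule absolutely_continuousI_density) simp
      moreover have "{?p} \<in> null_sets lborel" by (simp add: null_sets_def)
      ultimately show ?thesis unfolding absolutely_continuous_def by blast
    qed
    finally show "(\<integral>\<^sup>+y. indicator H (x(j := y)) \<partial>?N) = 0" by simp
  qed
  finally have "H \<in> null_sets (Pi\<^sub>M {..<k} (\<lambda>_. ?N))" using H by (simp add: null_sets_def)
  then show ?thesis by (rule AE_I') (auto simp: H_def)
qed

text \<open>The sums are the diagonal entries of the two mixtures. The last clause says that their
  ratios are pairwise distinct, cross-multiplied to avoid division.\<close>

definition separated_mixes :: "nat \<Rightarrow> nat \<Rightarrow> (nat \<Rightarrow> nat \<Rightarrow> real) \<Rightarrow> (nat \<Rightarrow> real) \<Rightarrow> (nat \<Rightarrow> real) \<Rightarrow> bool" where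
  "separated_mixes k r \<alpha> u v \<longleftrightarrow>
     (\<forall>l<r. (\<Sum>j<k. \<alpha> l j * u j) \<noteq> 0) \<and> (\<forall>l<r. (\<Sum>j<k. \<alpha> l j * v j) \<noteq> 0) \<and>
     (\<forall>l<r. \<forall>l'<r. l \<noteq> l' \<longrightarrow> (\<Sum>j<k. \<alpha> l j * u j) * (\<Sum>j<k. \<alpha> l' j * v j)
        \<noteq> (\<Sum>j<k. \<alpha> l' j * u j) * (\<Sum>j<k. \<alpha> l j * v j))"

text \<open>For almost every \<open>u\<close> all diagonal entries are nonzero. With such a
  \<open>u\<close> fixed, each pair of indices excludes a hyperplane of vectors \<open>v\<close>,
  which is proper because \<open>\<alpha> l\<close> and \<open>\<alpha> l'\<close> are
  independent.\<close>

lemma AE_separated_mixes: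
  fixes \<alpha> :: "nat \<Rightarrow> nat \<Rightarrow> real"
  assumes nz: "\<And>l. l < r \<Longrightarrow> \<exists>j<k. \<alpha> l j \<noteq> 0"
    and ind: "\<And>l l' c c'. l < r \<Longrightarrow> l' < r \<Longrightarrow> l \<noteq> l' \<Longrightarrow> (\<And>j. j < k \<Longrightarrow> c * \<alpha> l j + c' * \<alpha> l' j = 0)
      \<Longrightarrow> c = 0"
  defines "G \<equiv> Pi\<^sub>M {..<k} (\<lambda>_. density lborel std_normal_density)"
  shows "{\<omega>\<in>space (G \<Otimes>\<^sub>M G). separated_mixes k r \<alpha> (fst \<omega>) (snd \<omega>)} \<in> sets (G \<Otimes>\<^sub>M G)"
    and "AE \<omega> in G \<Otimes>\<^sub>M G. separated_mixes k r \<alpha> (fst \<omega>) (snd \<omega>)"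
proof -
  interpret P: prob_space G unfolding G_def by (rule prob_space_PiM) (rule prob_space_std_normal)
  interpret GG: pair_sigma_finite G G by unfold_locales
  have [measurable]: "(\<lambda>x. x i) \<in> borel_measurable G" if "i < k" for i
    using measurable_component_singleton[of i "{..<k}" "\<lambda>_. density lborel std_normal_density"] that
    by (simp add: G_def)
  have [measurable]: "(\<lambda>x. \<Sum>j<k. \<alpha> l j * x j) \<in> borel_measurable G" for l by measurable
  have [measurable]: "(\<lambda>\<omega>. \<Sum>j<k. \<alpha> l j * fst \<omega> j) \<in> borel_measurable (G \<Otimes>\<^sub>M G)" for l
    by (rule measurable_compose[OF measurable_fst]) measurable
  have [measurable]: "(\<lambda>\<omega>. \<Sum>j<k. \<alpha> l j * snd \<omega> j) \<in> borel_measurable (G \<Otimes>\<^sub>M G)" for l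
    by (rule measurable_compose[OF measurable_snd]) measurable
  show meas: "{\<omega>\<in>space (G \<Otimes>\<^sub>M G). separated_mixes k r \<alpha> (fst \<omega>) (snd \<omega>)} \<in> sets (G \<Otimes>\<^sub>M G)"
    unfolding separated_mixes_def by measurable
  have AE1: "AE x in G. (\<Sum>j<k. b j * x j) \<noteq> 0" if "\<exists>j<k. b j \<noteq> 0" for b :: "nat \<Rightarrow> real"
    using that gaussian_hyperplane_null[of _ k b] unfolding G_def by blast
  have all: "AE x in G. \<forall>l<r. (\<Sum>j<k. \<alpha> l j * x j) \<noteq> 0"
  proof -
    have "AE x in G. \<forall>l\<in>{..<r}. (\<Sum>j<k. \<alpha> l j * x j) \<noteq> 0"
      by (rule AE_finite_allI) (simp, rule AE1, rule nz, simp)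
    then show ?thesis by (simp add: Ball_def)
  qed
  show "AE \<omega> in G \<Otimes>\<^sub>M G. separated_mixes k r \<alpha> (fst \<omega>) (snd \<omega>)"
  proof (rule GG.AE_pair_measure[OF meas])
    show "AE u in G. AE v in G. separated_mixes k r \<alpha> (fst (u, v)) (snd (u, v))"
      using all
    proof eventually_elim
      fix u assume u: "\<forall>l<r. (\<Sum>j<k. \<alpha> l j * u j) \<noteq> 0"
      let ?d = "\<lambda>l. \<Sum>j<k. \<alpha> l j * u j"
      have one: "AE v in G. l \<noteq> l' \<longrightarrow>
          ?d l * (\<Sum>j<k. \<alpha> l' j * v j) \<noteq> ?d l' * (\<Sum>j<k. \<alpha> l j * v j)" if l: "l < r" "l' < r" for l l'
      proof (cases "l = l'")
        case False
        \<comment> \<open>Coefficients of the linear form in \<open>v\<close> whose vanishing means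
          that two ratios coincide.\<close>
        let ?b = "\<lambda>j. ?d l * \<alpha> l' j - ?d l' * \<alpha> l j"
        have "\<exists>j<k. ?b j \<noteq> 0"
        proof (rule ccontr)
          assume "\<not> ?thesis"
          then have "- ?d l' * \<alpha> l j + ?d l * \<alpha> l' j = 0" if "j < k" for j using that by auto
          then have "- ?d l' = 0" using ind[OF l False, of "- ?d l'" "?d l"] by blast
          then show False using u l by simp
        qed
        then have "AE v in G. (\<Sum>j<k. ?b j * v j) \<noteq> 0" by (rule AE1)
        then show ?thesis
        proof eventually_elim
          fix v assume "(\<Sum>j<k. ?b j * v j) \<noteq> 0"
          moreover have "(\<Sum>j<k. ?b j * v j)
              = ?d l * (\<Sum>j<k. \<alpha> l' j * v j) - ?d l' * (\<Sum>j<k. \<alpha> l j * v j)"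
            unfolding left_diff_distrib sum_subtractf sum_distrib_left[of "?d l"] sum_distrib_left[of "?d l'"]
            by (simp only: mult.assoc)
          ultimately show "l \<noteq> l' \<longrightarrow>
              ?d l * (\<Sum>j<k. \<alpha> l' j * v j) \<noteq> ?d l' * (\<Sum>j<k. \<alpha> l j * v j)" by auto
        qed
      qed simp
      have "AE v in G. \<forall>p\<in>{..<r} \<times> {..<r}. fst p \<noteq> snd p \<longrightarrow>
          ?d (fst p) * (\<Sum>j<k. \<alpha> (snd p) j * v j) \<noteq> ?d (snd p) * (\<Sum>j<k. \<alpha> (fst p) j * v j)"
        by (rule AE_finite_allI) (use one in auto)
      then show "AE v in G. separated_mixes k r \<alpha> (fst (u, v)) (snd (u, v))"
        using all
      proof eventually_elim
        fix v
        assume "\<forall>p\<in>{..<r} \<times> {..<r}. fst p \<noteq> snd p \<longrightarrow>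
            ?d (fst p) * (\<Sum>j<k. \<alpha> (snd p) j * v j) \<noteq> ?d (snd p) * (\<Sum>j<k. \<alpha> (fst p) j * v j)"
          and "\<forall>l<r. (\<Sum>j<k. \<alpha> l j * v j) \<noteq> 0"
        then show "separated_mixes k r \<alpha> (fst (u, v)) (snd (u, v))"
          using u unfolding separated_mixes_def by force
      qed
    qed
  qed
qed

section \<open>Jennrich's algorithm\<close>

definition left_inverse :: "nat \<Rightarrow> nat \<Rightarrow> mat \<Rightarrow> mat \<Rightarrow> bool" where
  "left_inverse n r A G \<longleftrightarrow> (\<forall>l<r. \<forall>k<r. (\<Sum>i<n. G l i * A i k) = (if k = l then 1 else 0))"

text \<open>In matrix form (a^T G)(A b) = a^T b, from G A = I. The pseudoinverse computations below
  collapse through it.\<close>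

lemma left_inverse_contract:
  assumes "left_inverse n r A G"
  shows "(\<Sum>i<n. (\<Sum>l<r. a l * G l i) * (\<Sum>k<r. A i k * b k)) = (\<Sum>l<r. a l * b l)"
proof -
  have "(\<Sum>i<n. (\<Sum>l<r. a l * G l i) * (\<Sum>k<r. A i k * b k))
      = (\<Sum>i<n. \<Sum>l<r. \<Sum>k<r. a l * (b k * (G l i * A i k)))"
    unfolding sum_product by (simp only: mult_ac)
  also have "\<dots> = (\<Sum>l<r. \<Sum>i<n. \<Sum>k<r. a l * (b k * (G l i * A i k)))" by (rule sum.swap)
  also have "\<dots> = (\<Sum>l<r. \<Sum>k<r. \<Sum>i<n. a l * (b k * (G l i * A i k)))"
    by (rule sum.cong[OF refl], rule sum.swap)
  also have "\<dots> = (\<Sum>l<r. a l * (\<Sum>k<r. b k * (\<Sum>i<n. G l i * A i k)))"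
    by (simp only: sum_distrib_left)
  also have "\<dots> = (\<Sum>l<r. a l * b l)"
  proof (rule sum.cong)
    fix l assume l: "l \<in> {..<r}"
    have "(\<Sum>k<r. b k * (\<Sum>i<n. G l i * A i k)) = (\<Sum>k<r. b k * (if k = l then 1 else 0))"
      using assms l by (intro sum.cong) (auto simp: left_inverse_def)
    also have "\<dots> = b l" using l by (intro sum_mult_delta) auto
    finally show "a l * (\<Sum>k<r. b k * (\<Sum>i<n. G l i * A i k)) = a l * b l" by simp
  qed simp
  finally show ?thesis .
qed

lemma left_inverse_apply:
  assumes "left_inverse n r A G" "l < r"
  shows "(\<Sum>i<n. G l i * (\<Sum>k<r. A i k * b k)) = b l"
proof -
  have "(\<Sum>i<n. (\<Sum>m<r. (if m = l then 1 else 0) * G m i) * (\<Sum>k<r. A i k * b k))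
      = (\<Sum>m<r. (if m = l then 1 else 0) * b m)"
    by (rule left_inverse_contract[OF assms(1)])
  moreover have "(\<Sum>m<r. (if m = l then 1 else 0) * x m) = x l" for x :: "nat \<Rightarrow> real"
    using sum_mult_delta[of "{..<r}" l x] assms(2) by (simp only: mult.commute) simp
  ultimately show ?thesis by simp
qed

text \<open>G is the Gram-matrix inverse times the transpose of A; then AG is an orthogonal projection.\<close>
lemma symmetric_left_inverse_exists:
  assumes ind: "indep_cols {..<n} A {..<r}"
  shows "\<exists>G. left_inverse n r A G \<and>
    (\<forall>i j. (\<Sum>l<r. A i l * G l j) = (\<Sum>l<r. A j l * G l i))"
proof -
  let ?Q = "\<lambda>m k. \<Sum>i<n. A i m * A i k"
  have inj: "\<forall>k\<in>{..<r}. y k = 0" if y: "\<forall>m\<in>{..<r}. (\<Sum>k<r. ?Q m k * y k) = 0" for y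
  proof -
    have "(\<Sum>i<n. (\<Sum>k<r. A i k * y k)\<^sup>2) = (\<Sum>m<r. y m * (\<Sum>k<r. ?Q m k * y k))"
    proof -
      have "(\<Sum>i<n. (\<Sum>k<r. A i k * y k)\<^sup>2) = (\<Sum>i<n. \<Sum>m<r. \<Sum>k<r. y m * (A i m * A i k * y k))"
        unfolding power2_eq_square sum_product by (simp only: mult_ac)
      also have "\<dots> = (\<Sum>m<r. \<Sum>i<n. \<Sum>k<r. y m * (A i m * A i k * y k))" by (rule sum.swap)
      also have "\<dots> = (\<Sum>m<r. \<Sum>k<r. \<Sum>i<n. y m * (A i m * A i k * y k))"
        by (rule sum.cong[OF refl], rule sum.swap)
      also have "\<dots> = (\<Sum>m<r. y m * (\<Sum>k<r. ?Q m k * y k))"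
        by (simp only: sum_distrib_left sum_distrib_right)
      finally show ?thesis .
    qed
    also have "\<dots> = 0" using y by simp
    finally have "\<forall>i\<in>{..<n}. (\<Sum>k<r. A i k * y k)\<^sup>2 = 0"
      by (subst (asm) sum_nonneg_eq_0_iff) auto
    then show ?thesis using ind unfolding indep_cols_def by simp
  qed
  have "\<forall>l. \<exists>y. \<forall>m\<in>{..<r}. (\<Sum>k<r. ?Q m k * y k) = (if m = l then 1 else 0)"
    by (intro allI, rule square_solvable) (simp, simp, simp, rule inj)
  from choice[OF this] obtain c
    where c': "\<forall>l. \<forall>m\<in>{..<r}. (\<Sum>k<r. ?Q m k * c l k) = (if m = l then 1 else 0)" ..
  have c: "(\<Sum>k<r. ?Q m k * c l k) = (if m = l then 1 else 0)" if "m < r" for l m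
    using c' that by simp
  define G where "G l i = (\<Sum>k<r. A i k * c l k)" for l i
  have GA: "left_inverse n r A G"
    unfolding left_inverse_def
  proof (intro allI impI)
    fix l m assume "l < r" "m < r"
    have "(\<Sum>i<n. G l i * A i m) = (\<Sum>i<n. \<Sum>k<r. A i m * A i k * c l k)"
      unfolding G_def sum_distrib_right by (simp only: mult_ac)
    also have "\<dots> = (\<Sum>k<r. ?Q m k * c l k)"
      by (subst sum.swap) (simp only: sum_distrib_right)
    finally show "(\<Sum>i<n. G l i * A i m) = (if m = l then 1 else 0)" using c \<open>m < r\<close> by simp
  qed
  define P where "P i j = (\<Sum>l<r. A i l * G l j)" for i j
  have PG: "(\<Sum>k<n. P i k * G l k) = G l i" for i l
    unfolding P_def G_def[of l] by (rule left_inverse_contract[OF GA])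
  \<comment> \<open>P^T = P P^T, and the right-hand side is symmetric.\<close>
  have PP: "P j i = (\<Sum>k<n. P i k * P j k)" for i j
  proof -
    have "(\<Sum>k<n. P i k * P j k) = (\<Sum>k<n. \<Sum>l<r. A j l * (P i k * G l k))"
      unfolding P_def[of j] sum_distrib_left by (simp only: mult_ac)
    also have "\<dots> = (\<Sum>l<r. A j l * (\<Sum>k<n. P i k * G l k))"
      by (subst sum.swap) (simp only: sum_distrib_left)
    finally show ?thesis unfolding PG by (simp only: P_def[of j i])
  qed
  have "P i j = P j i" for i j
    unfolding PP[of i j] PP[of j i] by (simp only: mult.commute)
  then show ?thesis using GA unfolding P_def by blast
qed

section \<open>The Moore-Penrose inverse of a factored matrix\<close>

lemma matmul_assoc: "matmul k (matmul l A B) C = matmul l A (matmul k B C)"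
proof (intro ext)
  fix i j
  have "matmul k (matmul l A B) C i j = (\<Sum>t<k. \<Sum>s<l. A i s * (B s t * C t j))"
    unfolding matmul_def by (simp only: sum_distrib_right mult.assoc)
  also have "\<dots> = matmul l A (matmul k B C) i j"
    unfolding matmul_def by (subst sum.swap) (simp only: sum_distrib_left)
  finally show "matmul k (matmul l A B) C i j = matmul l A (matmul k B C) i j" .
qed

lemma matmul_cong:
  "(\<And>t. t < k \<Longrightarrow> A i t = A' i t) \<Longrightarrow> (\<And>t. t < k \<Longrightarrow> B t j = B' t j) \<Longrightarrow>
    matmul k A B i j = matmul k A' B' i j"
  unfolding matmul_def by (intro sum.cong) auto

definition is_pinv :: "nat \<Rightarrow> nat \<Rightarrow> mat \<Rightarrow> mat \<Rightarrow> bool" where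
  "is_pinv m n A P \<longleftrightarrow> (\<forall>i j. \<not> (i < n \<and> j < m) \<longrightarrow> P i j = 0) \<and>
       (\<forall>i<m. \<forall>j<n. matmul m (matmul n A P) A i j = A i j) \<and>
       (\<forall>i<n. \<forall>j<m. matmul n (matmul m P A) P i j = P i j) \<and>
       (\<forall>i<m. \<forall>j<m. matmul n A P i j = matmul n A P j i) \<and>
       (\<forall>i<n. \<forall>j<n. matmul m P A i j = matmul m P A j i)"

text \<open>E = F E = (E F)^T = F^T = F. It is meant for E = A P and F = A Q with two pseudoinverses
  P and Q of A.\<close>

lemma symmetric_products_eq:
  assumes "\<And>i j. i < m \<Longrightarrow> j < m \<Longrightarrow> E i j = matmul m F E i j"
    and "\<And>i j. i < m \<Longrightarrow> j < m \<Longrightarrow> F i j = matmul m E F i j"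
    and "\<And>i j. i < m \<Longrightarrow> j < m \<Longrightarrow> E i j = E j i" "\<And>i j. i < m \<Longrightarrow> j < m \<Longrightarrow> F i j = F j i"
    and ij: "i < m" "j < m"
  shows "E i j = F i j"
proof -
  have "E i j = (\<Sum>t<m. F i t * E t j)" using assms(1)[OF ij] by (simp add: matmul_def)
  also have "\<dots> = (\<Sum>t<m. E j t * F t i)"
  proof (rule sum.cong)
    fix t assume "t \<in> {..<m}"
    then show "F i t * E t j = E j t * F t i"
      using assms(3)[of t j] assms(4)[of i t] ij by simp
  qed simp
  also have "\<dots> = F j i" using assms(2)[of j i] ij by (simp add: matmul_def)
  also have "\<dots> = F i j" using assms(4) ij by blast
  finally show ?thesis .
qed

text \<open>The transposed version, for E = P A and F = Q A, where the products absorb on the other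
  side.\<close>

lemma symmetric_products_eq':
  assumes E: "\<And>i j. i < m \<Longrightarrow> j < m \<Longrightarrow> E i j = matmul m E F i j"
    and F: "\<And>i j. i < m \<Longrightarrow> j < m \<Longrightarrow> F i j = matmul m F E i j"
    and sE: "\<And>i j. i < m \<Longrightarrow> j < m \<Longrightarrow> E i j = E j i" and sF: "\<And>i j. i < m \<Longrightarrow> j < m \<Longrightarrow> F i j = F j i"
    and ij: "i < m" "j < m"
  shows "E i j = F i j"
proof (rule symmetric_products_eq[OF _ _ sE sF ij])
  have tr: "matmul m F E i j = matmul m E F j i" "matmul m E F i j = matmul m F E j i"
    if "i < m" "j < m" for i j
    unfolding matmul_def
    by (rule sum.cong; use that in \<open>simp add: sE[of _ j] sF[of i] sE[of i] sF[of _ j]\<close>)+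
  show "E i j = matmul m F E i j" "F i j = matmul m E F i j" if "i < m" "j < m" for i j
    using tr[OF that] E[OF that(2,1)] F[OF that(2,1)] sE[OF that] sF[OF that] by auto
qed

text \<open>Penrose's argument: A P = A Q and P A = Q A by symmetry of these products, so P = P A P
  = Q A P = Q A Q = Q. The prescribed zeros outside the format make this an equality of
  functions.\<close>

lemma is_pinv_unique:
  assumes P: "is_pinv m n A P" and Q: "is_pinv m n A Q"
  shows "P = Q"
proof (intro ext)
  fix i j
  have eqL: "matmul n A P i j = matmul n A Q i j" if "i < m" "j < m" for i j
  proof (rule symmetric_products_eq[where E = "matmul n A P" and F = "matmul n A Q", OF _ _ _ _ that])
    fix i j assume ij: "i < m" "j < m"
    show "matmul n A P i j = matmul m (matmul n A Q) (matmul n A P) i j"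
      unfolding matmul_assoc[where k = n and l = m and A = "matmul n A Q" and B = A and C = P, symmetric]
      by (rule matmul_cong) (use Q ij in \<open>auto simp: is_pinv_def\<close>)
    show "matmul n A Q i j = matmul m (matmul n A P) (matmul n A Q) i j"
      unfolding matmul_assoc[where k = n and l = m and A = "matmul n A P" and B = A and C = Q, symmetric]
      by (rule matmul_cong) (use P ij in \<open>auto simp: is_pinv_def\<close>)
  qed (use P Q in \<open>auto simp: is_pinv_def\<close>)
  have eqR: "matmul m P A i j = matmul m Q A i j" if "i < n" "j < n" for i j
  proof (rule symmetric_products_eq'[where E = "matmul m P A" and F = "matmul m Q A", OF _ _ _ _ that])
    fix i j assume ij: "i < n" "j < n"
    show "matmul m P A i j = matmul n (matmul m P A) (matmul m Q A) i j"
      unfolding matmul_assoc[where k = n and l = m and A = P and B = A and C = "matmul m Q A"] matmul_assoc[where k = m and l = n and A = A and B = Q and C = A, symmetric]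
      by (rule matmul_cong) (use Q ij in \<open>auto simp: is_pinv_def\<close>)
    show "matmul m Q A i j = matmul n (matmul m Q A) (matmul m P A) i j"
      unfolding matmul_assoc[where k = n and l = m and A = Q and B = A and C = "matmul m P A"] matmul_assoc[where k = m and l = n and A = A and B = P and C = A, symmetric]
      by (rule matmul_cong) (use P ij in \<open>auto simp: is_pinv_def\<close>)
  qed (use P Q in \<open>auto simp: is_pinv_def\<close>)
  show "P i j = Q i j"
  proof (cases "i < n \<and> j < m")
    case True
    have "P i j = matmul n (matmul m P A) P i j" using P True by (simp add: is_pinv_def)
    also have "\<dots> = matmul n (matmul m Q A) P i j"
      by (rule matmul_cong) (use eqR True in auto)
    also have "\<dots> = matmul m Q (matmul n A P) i j" by (simp only: matmul_assoc)
    also have "\<dots> = matmul m Q (matmul n A Q) i j"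
      by (rule matmul_cong) (use eqL True in auto)
    also have "\<dots> = matmul n (matmul m Q A) Q i j" by (simp only: matmul_assoc)
    also have "\<dots> = Q i j" using Q True by (simp add: is_pinv_def)
    finally show ?thesis .
  next
    case False
    then show ?thesis using P Q by (simp add: is_pinv_def)
  qed
qed

lemma pinv_eqI: "is_pinv m n A P \<Longrightarrow> pinv m n A = P"
  unfolding pinv_def is_pinv_def[symmetric]
  by (rule the_equality) (auto intro: is_pinv_unique)

text \<open>For X = A D B^T the inverse is H^T D^-1 G. The symmetry conditions of Penrose become
  symmetry of A G and B H, which is why the left inverses are chosen symmetric in this
  sense.\<close>

lemma pinv_factor:
  assumes G: "left_inverse m r A G" "\<And>i j. (\<Sum>l<r. A i l * G l j) = (\<Sum>l<r. A j l * G l i)"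
    and H: "left_inverse n r B H" "\<And>i j. (\<Sum>l<r. B i l * H l j) = (\<Sum>l<r. B j l * H l i)"
    and X: "\<And>i j. i < m \<Longrightarrow> j < n \<Longrightarrow> X i j = (\<Sum>l<r. A i l * (e l * B j l))"
    and e: "\<And>l. l < r \<Longrightarrow> e l \<noteq> 0"
  shows "pinv m n X = (\<lambda>j i. if j < n \<and> i < m then \<Sum>l<r. H l j * (G l i / e l) else 0)"
proof (rule pinv_eqI)
  let ?P = "\<lambda>j i. if j < n \<and> i < m then \<Sum>l<r. H l j * (G l i / e l) else 0"
  have XP: "matmul n X ?P i i' = (\<Sum>l<r. A i l * G l i')" if "i < m" "i' < m" for i i'
  proof -
    have "matmul n X ?P i i' = (\<Sum>j<n. (\<Sum>l<r. (G l i' / e l) * H l j) * (\<Sum>k<r. B j k * (A i k * e k)))"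
      unfolding matmul_def
    proof (rule sum.cong)
      fix j assume "j \<in> {..<n}"
      then have "X i j = (\<Sum>k<r. B j k * (A i k * e k))"
        "?P j i' = (\<Sum>l<r. (G l i' / e l) * H l j)"
        using X that by (simp_all add: mult_ac)
      then show "X i j * ?P j i' = (\<Sum>l<r. (G l i' / e l) * H l j) * (\<Sum>k<r. B j k * (A i k * e k))"
        by (simp only: mult.commute)
    qed simp
    also have "\<dots> = (\<Sum>l<r. (G l i' / e l) * (A i l * e l))" by (rule left_inverse_contract[OF H(1)])
    also have "\<dots> = (\<Sum>l<r. A i l * G l i')" by (rule sum.cong) (use e in auto)
    finally show ?thesis .
  qed
  have PX: "matmul m ?P X j j' = (\<Sum>l<r. B j' l * H l j)" if "j < n" "j' < n" for j j'
  proof -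
    have "matmul m ?P X j j' = (\<Sum>i<m. (\<Sum>l<r. (H l j / e l) * G l i) * (\<Sum>k<r. A i k * (e k * B j' k)))"
      unfolding matmul_def by (rule sum.cong) (use X that in \<open>simp_all add: mult_ac\<close>)
    also have "\<dots> = (\<Sum>l<r. (H l j / e l) * (e l * B j' l))" by (rule left_inverse_contract[OF G(1)])
    also have "\<dots> = (\<Sum>l<r. B j' l * H l j)" by (rule sum.cong) (use e in auto)
    finally show ?thesis .
  qed
  have XPX: "matmul m (matmul n X ?P) X i j = X i j" if "i < m" "j < n" for i j
  proof -
    have "matmul m (matmul n X ?P) X i j
        = (\<Sum>i'<m. (\<Sum>l<r. A i l * G l i') * (\<Sum>k<r. A i' k * (e k * B j k)))"
      unfolding matmul_def[of m] by (rule sum.cong) (use X XP that in simp_all)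
    also have "\<dots> = X i j" unfolding left_inverse_contract[OF G(1)] using X that by simp
    finally show ?thesis .
  qed
  have PXP: "matmul n (matmul m ?P X) ?P j i = ?P j i" if "j < n" "i < m" for j i
  proof -
    have "matmul n (matmul m ?P X) ?P j i
        = (\<Sum>j'<n. (\<Sum>l<r. (G l i / e l) * H l j') * (\<Sum>k<r. B j' k * H k j))"
      unfolding matmul_def[of n]
    proof (rule sum.cong)
      fix j' assume "j' \<in> {..<n}"
      then have "matmul m ?P X j j' = (\<Sum>k<r. B j' k * H k j)" "?P j' i = (\<Sum>l<r. (G l i / e l) * H l j')"
        using PX that by (simp_all add: mult_ac)
      then show "matmul m ?P X j j' * ?P j' i = (\<Sum>l<r. (G l i / e l) * H l j') * (\<Sum>k<r. B j' k * H k j)"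
        by (simp only: mult.commute)
    qed simp
    also have "\<dots> = (\<Sum>l<r. (G l i / e l) * H l j)" by (rule left_inverse_contract[OF H(1)])
    finally show ?thesis using that by (simp add: mult.commute)
  qed
  show "is_pinv m n X ?P"
    unfolding is_pinv_def
  proof (intro conjI allI impI)
    show "matmul m (matmul n X ?P) X i j = X i j" if "i < m" "j < n" for i j
      by (rule XPX[OF that])
    show "matmul n (matmul m ?P X) ?P i j = ?P i j" if "i < n" "j < m" for i j
      by (rule PXP[OF that])
    show "matmul n X ?P i j = matmul n X ?P j i" if "i < m" "j < m" for i j
      unfolding XP[OF that] XP[OF that(2,1)] by (rule G(2))
    show "matmul m ?P X i j = matmul m ?P X j i" if "i < n" "j < n" for i j
      unfolding PX[OF that] PX[OF that(2,1)] by (rule H(2))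
  qed auto
qed

section \<open>Eigenvectors of factored matrices and their pairing\<close>

lemma factored_eigvec:
  assumes G: "left_inverse n r A G" and l: "l < r"
    and Y: "\<And>i j. i < n \<Longrightarrow> j < n \<Longrightarrow> Y i j = (\<Sum>l<r. A i l * (\<rho> l * G l j))"
  shows "is_eigvec n Y (\<rho> l) (\<lambda>i. A i l)"
  unfolding is_eigvec_def
proof (intro conjI allI impI)
  have one: "(\<Sum>i<n. G l i * A i l) = 1" using G l by (simp add: left_inverse_def)
  show "\<exists>i<n. A i l \<noteq> 0"
  proof (rule ccontr)
    assume "\<not> ?thesis"
    then have "(\<Sum>i<n. G l i * A i l) = 0" by (intro sum.neutral) auto
    then show False using one by simp
  qed
  fix i assume i: "i < n"
  have "(\<Sum>j<n. Y i j * A j l) = (\<Sum>j<n. \<Sum>k<r. A i k * \<rho> k * (G k j * A j l))"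
    using Y i by (intro sum.cong) (auto simp: sum_distrib_right mult.assoc)
  also have "\<dots> = (\<Sum>k<r. A i k * \<rho> k * (\<Sum>j<n. G k j * A j l))"
    by (subst sum.swap) (simp only: sum_distrib_left)
  also have "\<dots> = (\<Sum>k<r. A i k * \<rho> k * (if k = l then 1 else 0))"
    using G l by (intro sum.cong) (auto simp: left_inverse_def)
  also have "\<dots> = A i l * \<rho> l" using l by (intro sum_mult_delta) auto
  finally show "(\<Sum>j<n. Y i j * A j l) = \<rho> l * A i l" by (simp add: mult.commute)
qed

text \<open>Applying G to Y x = lam x gives lam c_k = \<rho>_k c_k for c = G x, so distinct values
  of \<rho> leave only one nonzero c_l. The condition lam \<noteq> 0 puts x into the column space of
  A, since lam x = Y x lies there.\<close>

lemma factored_eigvec_unique: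
  assumes G: "left_inverse n r A G"
    and Y: "\<And>i j. i < n \<Longrightarrow> j < n \<Longrightarrow> Y i j = (\<Sum>l<r. A i l * (\<rho> l * G l j))"
    and inj: "inj_on \<rho> {..<r}" and lam: "lam \<noteq> 0" and ev: "is_eigvec n Y lam x"
  shows "\<exists>l<r. lam = \<rho> l \<and> (\<exists>a. a \<noteq> 0 \<and> (\<forall>i<n. x i = a * A i l))"
proof -
  define c where "c l = (\<Sum>j<n. G l j * x j)" for l
  have Yx: "lam * x i = (\<Sum>l<r. A i l * (\<rho> l * c l))" if i: "i < n" for i
  proof -
    have "lam * x i = (\<Sum>j<n. Y i j * x j)" using ev i by (simp add: is_eigvec_def)
    also have "\<dots> = (\<Sum>j<n. \<Sum>l<r. A i l * (\<rho> l * (G l j * x j)))"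
      using Y i by (intro sum.cong) (auto simp: sum_distrib_right mult.assoc)
    also have "\<dots> = (\<Sum>l<r. A i l * (\<rho> l * c l))"
      unfolding c_def by (subst sum.swap) (simp only: sum_distrib_left)
    finally show ?thesis .
  qed
  have lc: "lam * c k = \<rho> k * c k" if k: "k < r" for k
  proof -
    have "lam * c k = (\<Sum>i<n. G k i * (lam * x i))"
      unfolding c_def sum_distrib_left by (simp only: mult.left_commute)
    also have "\<dots> = (\<Sum>i<n. G k i * (\<Sum>l<r. A i l * (\<rho> l * c l)))"
      using Yx by (intro sum.cong) auto
    also have "\<dots> = \<rho> k * c k" by (rule left_inverse_apply[OF G k])
    finally show ?thesis .
  qed
  have "\<exists>l<r. c l \<noteq> 0"
  proof (rule ccontr)
    assume "\<not> ?thesis"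
    then have "lam * x i = 0" if "i < n" for i using Yx[OF that] by simp
    then show False using lam ev unfolding is_eigvec_def by auto
  qed
  then obtain l where l: "l < r" "c l \<noteq> 0" by blast
  have lam_eq: "lam = \<rho> l" using lc[OF l(1)] l(2) by simp
  have c0: "c k = 0" if "k < r" "k \<noteq> l" for k
    using lc[OF that(1)] lam_eq inj_onD[OF inj, of k l] that l by auto
  have "x i = c l * A i l" if "i < n" for i
  proof -
    have "lam * x i = (\<Sum>k<r. A i k * (lam * c l) * (if k = l then 1 else 0))"
      unfolding Yx[OF that] by (rule sum.cong) (use c0 lam_eq in auto)
    also have "\<dots> = A i l * (lam * c l)" using l by (intro sum_mult_delta) auto
    finally have "lam * x i = lam * (c l * A i l)" by (simp only: mult_ac)
    then show ?thesis using lam by simp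
  qed
  then show ?thesis using l lam_eq by blast
qed

locale jennrich_setting =
  fixes n1 n2 r :: nat and A B Xu Xv :: mat and eu ev :: "nat \<Rightarrow> real"
  assumes indA: "indep_cols {..<n1} A {..<r}" and indB: "indep_cols {..<n2} B {..<r}"
    and Xu: "\<And>i j. i < n1 \<Longrightarrow> j < n2 \<Longrightarrow> Xu i j = (\<Sum>l<r. A i l * (eu l * B j l))"
    and Xv: "\<And>i j. i < n1 \<Longrightarrow> j < n2 \<Longrightarrow> Xv i j = (\<Sum>l<r. A i l * (ev l * B j l))"
    and eu: "\<And>l. l < r \<Longrightarrow> eu l \<noteq> 0" and ev: "\<And>l. l < r \<Longrightarrow> ev l \<noteq> 0"
    and sep: "\<And>l l'. l < r \<Longrightarrow> l' < r \<Longrightarrow> l \<noteq> l' \<Longrightarrow> eu l * ev l' \<noteq> eu l' * ev l"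
begin

text \<open>The inner factors cancel by H B = I and G A = I: the two matrices are A D_u D_v^-1 G and
  B D_v D_u^-1 H, where \<open>eu\<close> and \<open>ev\<close> are the diagonals of D_u and
  D_v.\<close>

lemma jennrich_products:
  obtains G H where "left_inverse n1 r A G" "left_inverse n2 r B H"
    "\<And>i j. i < n1 \<Longrightarrow> j < n1 \<Longrightarrow> matmul n2 Xu (pinv n1 n2 Xv) i j = (\<Sum>l<r. A i l * (eu l / ev l * G l j))"
    "\<And>i j. i < n2 \<Longrightarrow> j < n2 \<Longrightarrow> (\<Sum>t<n1. Xv t i * pinv n1 n2 Xu j t) = (\<Sum>l<r. B i l * (ev l / eu l * H l j))"
proof -
  obtain G where G: "left_inverse n1 r A G" "\<And>i j. (\<Sum>l<r. A i l * G l j) = (\<Sum>l<r. A j l * G l i)"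
    using symmetric_left_inverse_exists[OF indA] by blast
  obtain H where H: "left_inverse n2 r B H" "\<And>i j. (\<Sum>l<r. B i l * H l j) = (\<Sum>l<r. B j l * H l i)"
    using symmetric_left_inverse_exists[OF indB] by blast
  have pv: "pinv n1 n2 Xv t i = (\<Sum>l<r. H l t * (G l i / ev l))" if "t < n2" "i < n1" for t i
    using that by (simp add: pinv_factor[OF G H Xv ev])
  have pu: "pinv n1 n2 Xu t i = (\<Sum>l<r. H l t * (G l i / eu l))" if "t < n2" "i < n1" for t i
    using that by (simp add: pinv_factor[OF G H Xu eu])
  have Y1: "matmul n2 Xu (pinv n1 n2 Xv) i j = (\<Sum>l<r. A i l * (eu l / ev l * G l j))"
    if ij: "i < n1" "j < n1" for i j
  proof -
    have "matmul n2 Xu (pinv n1 n2 Xv) i j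
        = (\<Sum>t<n2. (\<Sum>l<r. (G l j / ev l) * H l t) * (\<Sum>k<r. B t k * (A i k * eu k)))"
      unfolding matmul_def
    proof (rule sum.cong)
      fix t assume t: "t \<in> {..<n2}"
      have "Xu i t = (\<Sum>k<r. B t k * (A i k * eu k))" using Xu[of i t] t ij by (simp add: mult_ac)
      moreover have "pinv n1 n2 Xv t j = (\<Sum>l<r. (G l j / ev l) * H l t)"
        using pv[of t j] t ij by (simp add: mult.commute)
      ultimately show "Xu i t * pinv n1 n2 Xv t j
          = (\<Sum>l<r. (G l j / ev l) * H l t) * (\<Sum>k<r. B t k * (A i k * eu k))"
        by (simp only: mult.commute)
    qed simp
    also have "\<dots> = (\<Sum>l<r. (G l j / ev l) * (A i l * eu l))" by (rule left_inverse_contract[OF H(1)])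
    finally show ?thesis by (simp add: mult_ac)
  qed
  have Y2: "(\<Sum>t<n1. Xv t i * pinv n1 n2 Xu j t) = (\<Sum>l<r. B i l * (ev l / eu l * H l j))"
    if ij: "i < n2" "j < n2" for i j
  proof -
    have "(\<Sum>t<n1. Xv t i * pinv n1 n2 Xu j t)
        = (\<Sum>t<n1. (\<Sum>l<r. (H l j / eu l) * G l t) * (\<Sum>k<r. A t k * (ev k * B i k)))"
    proof (rule sum.cong)
      fix t assume t: "t \<in> {..<n1}"
      have "pinv n1 n2 Xu j t = (\<Sum>l<r. (H l j / eu l) * G l t)"
        using pu[of j t] t ij by simp
      moreover have "Xv t i = (\<Sum>k<r. A t k * (ev k * B i k))" using Xv[of t i] t ij by simp
      ultimately show "Xv t i * pinv n1 n2 Xu j t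
          = (\<Sum>l<r. (H l j / eu l) * G l t) * (\<Sum>k<r. A t k * (ev k * B i k))"
        by (simp only: mult.commute)
    qed simp
    also have "\<dots> = (\<Sum>l<r. (H l j / eu l) * (ev l * B i l))" by (rule left_inverse_contract[OF G(1)])
    finally show ?thesis by (simp add: mult_ac)
  qed
  show ?thesis using that[OF G(1) H(1) Y1 Y2] .
qed

lemma ratio_inj: "inj_on (\<lambda>l. eu l / ev l) {..<r}" "inj_on (\<lambda>l. ev l / eu l) {..<r}"
proof -
  show "inj_on (\<lambda>l. eu l / ev l) {..<r}"
  proof (rule inj_onI, rule ccontr)
    fix l k assume "l \<in> {..<r}" "k \<in> {..<r}" "eu l / ev l = eu k / ev k" "l \<noteq> k"
    then show False using sep[of l k] ev by (simp add: frac_eq_eq)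
  qed
  show "inj_on (\<lambda>l. ev l / eu l) {..<r}"
  proof (rule inj_onI, rule ccontr)
    fix l k assume "l \<in> {..<r}" "k \<in> {..<r}" "ev l / eu l = ev k / eu k" "l \<noteq> k"
    then show False using sep[of k l] eu by (simp add: frac_eq_eq mult.commute)
  qed
qed

text \<open>The true factors are themselves a possible output, so correctness for all outputs is not
  vacuous.\<close>

lemma jennrich_output_factors: "jennrich_output n1 n2 r Xu Xv A B"
proof -
  obtain G H where GH: "left_inverse n1 r A G" "left_inverse n2 r B H"
    and Y1: "\<And>i j. i < n1 \<Longrightarrow> j < n1 \<Longrightarrow> matmul n2 Xu (pinv n1 n2 Xv) i j = (\<Sum>l<r. A i l * (eu l / ev l * G l j))"
    and Y2: "\<And>i j. i < n2 \<Longrightarrow> j < n2 \<Longrightarrow> (\<Sum>t<n1. Xv t i * pinv n1 n2 Xu j t) = (\<Sum>l<r. B i l * (ev l / eu l * H l j))"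
    by (rule jennrich_products) blast
  show ?thesis
    unfolding jennrich_output_def Let_def
  proof (intro exI[of _ "\<lambda>l. eu l / ev l"] conjI allI impI)
    fix l assume l: "l < r"
    show "eu l / ev l \<noteq> 0" using l eu ev by simp
    show "is_eigvec n1 (matmul n2 Xu (pinv n1 n2 Xv)) (eu l / ev l) (\<lambda>i. A i l)"
      by (rule factored_eigvec[OF GH(1) l, where \<rho> = "\<lambda>l. eu l / ev l"]) (rule Y1)
    have "is_eigvec n2 (\<lambda>i j. \<Sum>t<n1. Xv t i * pinv n1 n2 Xu j t) (ev l / eu l) (\<lambda>i. B i l)"
      by (rule factored_eigvec[OF GH(2) l, where \<rho> = "\<lambda>l. ev l / eu l"]) (rule Y2)
    then show "is_eigvec n2 (\<lambda>i j. \<Sum>t<n1. Xv t i * pinv n1 n2 Xu j t) (1 / (eu l / ev l)) (\<lambda>i. B i l)"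
      by simp
  qed (rule ratio_inj)
qed

text \<open>Mode 1 attaches to each output column an index \<open>k\<close> with eigenvalue
  \<open>eu k / ev k\<close>; the reciprocal eigenvalue in mode 2 must attach the same index since
  the ratios are distinct. Distinct eigenvalues make the index map injective, hence a
  permutation.\<close>

lemma jennrich_output_unique:
  assumes "jennrich_output n1 n2 r Xu Xv A1 A2"
  shows "\<exists>\<sigma> a b. bij_betw \<sigma> {..<r} {..<r} \<and> (\<forall>l<r. a l \<noteq> 0 \<and> b l \<noteq> 0 \<and>
      (\<forall>i<n1. A1 i l = a l * A i (\<sigma> l)) \<and> (\<forall>i<n2. A2 i l = b l * B i (\<sigma> l)))"
proof -
  obtain G H where GH: "left_inverse n1 r A G" "left_inverse n2 r B H"
    and Y1: "\<And>i j. i < n1 \<Longrightarrow> j < n1 \<Longrightarrow> matmul n2 Xu (pinv n1 n2 Xv) i j = (\<Sum>l<r. A i l * (eu l / ev l * G l j))"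
    and Y2: "\<And>i j. i < n2 \<Longrightarrow> j < n2 \<Longrightarrow> (\<Sum>t<n1. Xv t i * pinv n1 n2 Xu j t) = (\<Sum>l<r. B i l * (ev l / eu l * H l j))"
    by (rule jennrich_products) blast
  obtain lam where lam: "inj_on lam {..<r}" "\<And>l. l < r \<Longrightarrow> lam l \<noteq> 0"
    "\<And>l. l < r \<Longrightarrow> is_eigvec n1 (matmul n2 Xu (pinv n1 n2 Xv)) (lam l) (\<lambda>i. A1 i l)"
    "\<And>l. l < r \<Longrightarrow> is_eigvec n2 (\<lambda>i j. \<Sum>t<n1. Xv t i * pinv n1 n2 Xu j t) (1 / lam l) (\<lambda>i. A2 i l)"
    using assms unfolding jennrich_output_def Let_def by blast
  have one: "\<exists>k a b. k < r \<and> lam l = eu k / ev k \<and> a \<noteq> 0 \<and> b \<noteq> 0 \<and>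
      (\<forall>i<n1. A1 i l = a * A i k) \<and> (\<forall>i<n2. A2 i l = b * B i k)" if l: "l < r" for l
  proof -
    obtain k a where k: "k < r" "lam l = eu k / ev k" "a \<noteq> 0" "\<forall>i<n1. A1 i l = a * A i k"
      using factored_eigvec_unique[OF GH(1) Y1 ratio_inj(1) lam(2)[OF l] lam(3)[OF l]] by blast
    have "1 / lam l \<noteq> 0" using lam(2)[OF l] by simp
    then obtain k' b where k': "k' < r" "1 / lam l = ev k' / eu k'" "b \<noteq> 0" "\<forall>i<n2. A2 i l = b * B i k'"
      using factored_eigvec_unique[OF GH(2) Y2 ratio_inj(2) _ lam(4)[OF l]] by blast
    have "ev k / eu k = ev k' / eu k'" using k(2) k'(2) by simp
    then have "k = k'" using inj_onD[OF ratio_inj(2)] k(1) k'(1) by blast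
    then show ?thesis using k k' by blast
  qed
  then have "\<forall>l. \<exists>z. l < r \<longrightarrow> fst z < r \<and> lam l = eu (fst z) / ev (fst z) \<and> fst (snd z) \<noteq> 0 \<and> snd (snd z) \<noteq> 0 \<and>
      (\<forall>i<n1. A1 i l = fst (snd z) * A i (fst z)) \<and> (\<forall>i<n2. A2 i l = snd (snd z) * B i (fst z))"
    by simp
  from choice[OF this] obtain z where z: "\<And>l. l < r \<Longrightarrow> fst (z l) < r \<and> lam l = eu (fst (z l)) / ev (fst (z l)) \<and>
      fst (snd (z l)) \<noteq> 0 \<and> snd (snd (z l)) \<noteq> 0 \<and>
      (\<forall>i<n1. A1 i l = fst (snd (z l)) * A i (fst (z l))) \<and> (\<forall>i<n2. A2 i l = snd (snd (z l)) * B i (fst (z l)))"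
    by blast
  let ?\<sigma> = "\<lambda>l. fst (z l)"
  have inj: "inj_on ?\<sigma> {..<r}"
  proof (rule inj_onI)
    fix l k assume lk: "l \<in> {..<r}" "k \<in> {..<r}" "?\<sigma> l = ?\<sigma> k"
    then have "lam l = lam k" using z[of l] z[of k] by simp
    then show "l = k" using inj_onD[OF lam(1)] lk by blast
  qed
  have "?\<sigma> ` {..<r} = {..<r}"
    by (rule endo_inj_surj) (use inj z in auto)
  then have bij: "bij_betw ?\<sigma> {..<r} {..<r}" using inj by (simp add: bij_betw_def)
  show ?thesis
    by (intro exI[of _ ?\<sigma>] exI[of _ "\<lambda>l. fst (snd (z l))"] exI[of _ "\<lambda>l. snd (snd (z l))"] conjI allI impI)
      (use bij z in simp_all)
qed

end

section \<open>Recovery of the tensor\<close>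

lemma indep_colsD:
  "indep_cols R M J \<Longrightarrow> (\<And>i. i \<in> R \<Longrightarrow> (\<Sum>l\<in>J. M i l * c l) = 0) \<Longrightarrow> l \<in> J \<Longrightarrow> c l = 0"
  unfolding indep_cols_def by simp

lemma indep_cols_subset:
  assumes "indep_cols R M J" "I \<subseteq> J" "finite J"
  shows "indep_cols R M I"
  unfolding indep_cols_def
proof (intro allI impI)
  fix c assume c: "\<forall>i\<in>R. (\<Sum>l\<in>I. M i l * c l) = 0"
  let ?c = "\<lambda>l. if l \<in> I then c l else 0"
  have "(\<Sum>l\<in>J. M i l * ?c l) = (\<Sum>l\<in>I. M i l * c l)" for i
  proof -
    have "(\<Sum>l\<in>J. M i l * ?c l) = (\<Sum>l\<in>I. M i l * ?c l)"
      by (rule sum.mono_neutral_right) (use assms in auto)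
    then show ?thesis by (simp cong: sum.cong)
  qed
  then have "?c l = 0" if "l \<in> I" for l
    using indep_colsD[OF assms(1), of ?c l] c that assms(2) by auto
  then show "\<forall>l\<in>I. c l = 0" by simp
qed

text \<open>The Kruskal rank speaks of sets of exactly its own size, so the pair is enlarged to such
  a set, from which it inherits independence.\<close>

lemma kruskal_rank_ge_2D:
  assumes "2 \<le> kruskal_rank R r M"
  shows "2 \<le> r" "l < r \<Longrightarrow> k < r \<Longrightarrow> l \<noteq> k \<Longrightarrow> indep_cols R M {l, k}"
proof -
  let ?P = "\<lambda>k. k \<le> r \<and> (\<forall>J. J \<subseteq> {..<r} \<and> card J = k \<longrightarrow> indep_cols R M J)"
  let ?K = "kruskal_rank R r M"
  have "?P 0" by (auto simp: indep_cols_def dest: finite_subset)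
  then have K: "?P ?K" unfolding kruskal_rank_def
    by (rule GreatestI_nat[where k = 0 and b = r]) auto
  then show "2 \<le> r" using assms by simp
  assume lk: "l < r" "k < r" "l \<noteq> k"
  obtain J where J: "{l, k} \<subseteq> J" "J \<subseteq> {..<r}" "card J = ?K"
    using exists_subset_between[of "{l, k}" ?K "{..<r}"] lk K assms by auto
  then have "indep_cols R M J" using K by blast
  then show "indep_cols R M {l, k}"
    by (rule indep_cols_subset[OF _ J(1)]) (use J(2) finite_subset in blast)
qed

lemma mat_rank_fullD:
  assumes "mat_rank m r M = r"
  shows "indep_cols {..<m} M {..<r}"
proof -
  let ?S = "{card J | J. J \<subseteq> {..<r} \<and> indep_cols {..<m} M J}"
  have "?S = card ` {J. J \<subseteq> {..<r} \<and> indep_cols {..<m} M J}" by auto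
  then have "finite ?S" by simp
  moreover have "card ({} :: nat set) \<in> ?S" by (auto simp: indep_cols_def intro!: exI[of _ "{}"])
  ultimately have "r \<in> ?S" using assms Max_in[of ?S] unfolding mat_rank_def by auto
  then obtain J where "J \<subseteq> {..<r}" "indep_cols {..<m} M J" "card J = r" by auto
  moreover from this have "J = {..<r}" by (intro card_subset_eq) auto
  ultimately show ?thesis by simp
qed

lemma indep_cols_le_rows:
  assumes "indep_cols {..<m} M {..<r}"
  shows "r \<le> m"
proof (rule ccontr)
  assume "\<not> r \<le> m"
  then obtain c where "\<exists>j\<in>{..<r}. c j \<noteq> 0" "\<forall>i\<in>{..<m}. (\<Sum>j\<in>{..<r}. M i j * c j) = 0"
    using underdetermined[of "{..<m}" "{..<r}" M] by auto
  then show False using assms unfolding indep_cols_def by blast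
qed

text \<open>For each fixed row \<open>j\<close> of \<open>B\<close>, independence of the columns of
  \<open>A\<close> gives B_jl c_l = 0; with c_l \<noteq> 0 column \<open>l\<close> of
  \<open>B\<close> would be zero.\<close>

lemma khatri_rao_indep:
  assumes A: "indep_cols {..<n1} A {..<r}" and B: "indep_cols {..<n2} B {..<r}"
    and c: "\<forall>p\<in>{..<n1} \<times> {..<n2}. (\<Sum>l\<in>{..<r}. (A (fst p) l * B (snd p) l) * c l) = 0"
  shows "\<forall>l\<in>{..<r}. c l = 0"
proof
  fix l assume l: "l \<in> {..<r}"
  have Bc: "B j l * c l = 0" if "j < n2" for j
  proof -
    have "\<forall>i\<in>{..<n1}. (\<Sum>k<r. A i k * (B j k * c k)) = 0"
      using c that by (auto simp: mult.assoc)
    then show ?thesis using indep_colsD[OF A, of "\<lambda>k. B j k * c k" l] l by simp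
  qed
  have "(\<Sum>k<r. B j k * (if k = l then c l else 0)) = 0" if "j < n2" for j
    using Bc[OF that] by (intro sum.neutral) auto
  then show "c l = 0" using indep_colsD[OF B, of "\<lambda>k. if k = l then c l else 0" l] l by simp
qed

section \<open>Fibers of the tensor and reconstruction of the remaining factors\<close>

locale cp_tensor =
  fixes d r :: nat and ns istar :: "nat \<Rightarrow> nat" and A :: "nat \<Rightarrow> mat" and T :: "nat list \<Rightarrow> real"
  assumes d: "3 \<le> d"
    and T: "\<And>idx. idx \<in> tensor_index_set d ns \<Longrightarrow> T idx = cp_entry d r A idx"
    and nonzero: "\<And>k i l. k \<in> {2..<d} \<Longrightarrow> i < ns k \<Longrightarrow> l < r \<Longrightarrow> A k i l \<noteq> 0"
    and istar: "\<And>k. k \<in> {2..<d} \<Longrightarrow> istar k < ns k"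
    and ind0: "indep_cols {..<ns 0} (A 0) {..<r}" and ind1: "indep_cols {..<ns 1} (A 1) {..<r}"
begin

definition weight :: "nat \<Rightarrow> nat \<Rightarrow> real" where
  "weight k l = (\<Prod>m\<in>{2..<d} - {k}. A m (istar m) l)"

lemma weight_nonzero: "l < r \<Longrightarrow> weight k l \<noteq> 0"
  using nonzero istar by (auto simp: weight_def)

lemma prod_modes_split:
  fixes f :: "nat \<Rightarrow> real"
  assumes "k \<in> {2..<d}"
  shows "(\<Prod>m<d. f m) = f 0 * (f 1 * (f k * (\<Prod>m\<in>{2..<d} - {k}. f m)))"
proof -
  have "{..<d} = insert 0 (insert 1 {2..<d})" using d by auto
  then show ?thesis using prod.remove[of "{2..<d}" k f] assms by simp
qed

lemma T_fiber:
  assumes k: "k \<in> {2..<d}" and i: "i1 < ns 0" "i2 < ns 1" "i < ns k"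
  shows "T (fiber_index d istar k i1 i2 i) = (\<Sum>l<r. A 0 i1 l * (A 1 i2 l * (A k i l * weight k l)))"
proof -
  let ?x = "fiber_index d istar k i1 i2 i"
  have nth: "?x ! m = (if m = 0 then i1 else if m = 1 then i2 else if m = k then i else istar m)"
    if "m < d" for m
    using that by (simp add: fiber_index_def)
  have "?x \<in> tensor_index_set d ns"
    using nth i istar by (auto simp: tensor_index_set_def) (simp add: fiber_index_def)
  then have "T ?x = (\<Sum>l<r. \<Prod>m<d. A m (?x ! m) l)" using T by (simp add: cp_entry_def)
  also have "\<dots> = (\<Sum>l<r. A 0 i1 l * (A 1 i2 l * (A k i l * weight k l)))"
  proof (rule sum.cong)
    fix l assume "l \<in> {..<r}"
    have "(\<Prod>m\<in>{2..<d} - {k}. A m (?x ! m) l) = weight k l"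
      unfolding weight_def by (rule prod.cong) (auto simp: nth)
    then show "(\<Prod>m<d. A m (?x ! m) l) = A 0 i1 l * (A 1 i2 l * (A k i l * weight k l))"
      using k d by (simp add: prod_modes_split[OF k] nth)
  qed simp
  finally show ?thesis .
qed

text \<open>Scaling and permutation of the first two factors is all that Jennrich's algorithm leaves undetermined.\<close>
lemma cls_factor_eq:
  assumes \<sigma>: "bij_betw \<sigma> {..<r} {..<r}"
    and ab: "\<And>l. l < r \<Longrightarrow> a l \<noteq> 0 \<and> b l \<noteq> 0"
    and A1: "\<And>l i. l < r \<Longrightarrow> i < ns 0 \<Longrightarrow> A1 i l = a l * A 0 i (\<sigma> l)"
    and A2: "\<And>l i. l < r \<Longrightarrow> i < ns 1 \<Longrightarrow> A2 i l = b l * A 1 i (\<sigma> l)"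
    and L: "kr_independent_rows (ns 0) (ns 1) r A1 A2 L"
    and k: "k \<in> {2..<d}" "i < ns k" and l: "l < r"
  shows "cls_factor d r T istar A1 A2 L k i l = A k i (\<sigma> l) * weight k (\<sigma> l) / (a l * b l)"
proof -
  \<comment> \<open>The value 0 from index \<open>r\<close> on follows the convention in
    \<open>cls_factor\<close>, so that uniqueness holds for functions.\<close>
  let ?c = "\<lambda>l. if l < r then A k i (\<sigma> l) * weight k (\<sigma> l) / (a l * b l) else 0"
  have Lsub: "L \<subseteq> {..<ns 0} \<times> {..<ns 1}" and Lcard: "card L = r"
    and Lind: "\<And>y. \<forall>l<r. (\<Sum>p\<in>L. y p * (A1 (fst p) l * A2 (snd p) l)) = 0 \<Longrightarrow> \<forall>p\<in>L. y p = 0"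
    using L by (auto simp: kr_independent_rows_def)
  have fL: "finite L" using Lsub finite_subset by blast
  have sol: "(\<Sum>l<r. A1 (fst p) l * A2 (snd p) l * ?c l) = T (fiber_index d istar k (fst p) (snd p) i)"
    if p: "p \<in> L" for p
  proof -
    have p': "fst p < ns 0" "snd p < ns 1" using p Lsub by auto
    let ?F = "\<lambda>l. A 0 (fst p) l * (A 1 (snd p) l * (A k i l * weight k l))"
    have "(\<Sum>l<r. A1 (fst p) l * A2 (snd p) l * ?c l) = (\<Sum>l<r. ?F (\<sigma> l))"
      by (rule sum.cong) (use A1 A2 ab p' in auto)
    also have "\<dots> = (\<Sum>l<r. ?F l)" by (rule sum.reindex_bij_betw[OF \<sigma>])
    also have "\<dots> = T (fiber_index d istar k (fst p) (snd p) i)" using T_fiber[OF k(1) p' k(2)] by simp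
    finally show ?thesis .
  qed
  have "(THE c. (\<forall>l. r \<le> l \<longrightarrow> c l = 0) \<and>
      (\<forall>p\<in>L. (\<Sum>l<r. A1 (fst p) l * A2 (snd p) l * c l) = T (fiber_index d istar k (fst p) (snd p) i))) = ?c"
  proof (rule the_equality)
    show "(\<forall>l. r \<le> l \<longrightarrow> ?c l = 0) \<and>
      (\<forall>p\<in>L. (\<Sum>l<r. A1 (fst p) l * A2 (snd p) l * ?c l) = T (fiber_index d istar k (fst p) (snd p) i))"
      using sol by simp
  next
    fix c assume c: "(\<forall>l. r \<le> l \<longrightarrow> c l = 0) \<and>
      (\<forall>p\<in>L. (\<Sum>l<r. A1 (fst p) l * A2 (snd p) l * c l) = T (fiber_index d istar k (fst p) (snd p) i))"
    \<comment> \<open>The rows in \<open>L\<close> are independent and as many as the unknowns, so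
      by transposition the homogeneous system has only the zero solution.\<close>
    have "\<forall>l\<in>{..<r}. c l - ?c l = 0"
    proof (rule square_transpose_inj[where M = "\<lambda>l p. A1 (fst p) l * A2 (snd p) l" and J = L])
      show "\<forall>p\<in>L. (\<Sum>l<r. A1 (fst p) l * A2 (snd p) l * (c l - ?c l)) = 0"
        using c sol by (simp add: right_diff_distrib sum_subtractf)
      show "\<forall>p\<in>L. y p = 0" if "\<forall>l\<in>{..<r}. (\<Sum>p\<in>L. A1 (fst p) l * A2 (snd p) l * y p) = 0" for y
        by (rule Lind) (use that in \<open>simp add: mult.commute\<close>)
    qed (use fL Lcard in simp_all)
    then show "c = ?c" using c by (intro ext) (auto simp: not_less)
  qed
  then show ?thesis using l by (simp add: cls_factor_def)
qed

lemma atd_factors_correct: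
  assumes \<sigma>: "bij_betw \<sigma> {..<r} {..<r}"
    and ab: "\<And>l. l < r \<Longrightarrow> a l \<noteq> 0 \<and> b l \<noteq> 0"
    and A1: "\<And>l i. l < r \<Longrightarrow> i < ns 0 \<Longrightarrow> A1 i l = a l * A 0 i (\<sigma> l)"
    and A2: "\<And>l i. l < r \<Longrightarrow> i < ns 1 \<Longrightarrow> A2 i l = b l * A 1 i (\<sigma> l)"
    and L: "kr_independent_rows (ns 0) (ns 1) r A1 A2 L"
    and idx: "idx \<in> tensor_index_set d ns"
  shows "cp_entry d r (atd_factors d r T istar A1 A2 L) idx = T idx"
proof -
  let ?F = "atd_factors d r T istar A1 A2 L"
  let ?C = "\<lambda>k. cls_factor d r T istar A1 A2 L k"
  have idx_lt: "idx ! k < ns k" if "k < d" for k using idx that by (simp add: tensor_index_set_def)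
  have "(\<Prod>k<d. ?F k (idx ! k) l) = (\<Prod>k<d. A k (idx ! k) (\<sigma> l))" if l: "l < r" for l
  proof -
    let ?g = "\<lambda>k. A k (istar k) (\<sigma> l)" and ?x = "\<lambda>k. A k (idx ! k) (\<sigma> l)"
    define z where "z = (\<Prod>k\<in>{2..<d}. ?g k) / (a l * b l)"
    have sl: "\<sigma> l < r" using \<sigma> l by (auto simp: bij_betw_def)
    have g: "?g k \<noteq> 0" if "k \<in> {2..<d}" for k using nonzero istar that sl by blast
    have z: "z \<noteq> 0" using g ab[OF l] by (simp add: z_def)
    have gw: "?g k * weight k (\<sigma> l) = (\<Prod>k\<in>{2..<d}. ?g k)" if "k \<in> {2..<d}" for k
      using that by (simp add: weight_def prod.remove[of "{2..<d}" k])
    have C: "?C k i l = A k i (\<sigma> l) / ?g k * z" if "k \<in> {2..<d}" "i < ns k" for k i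
    proof -
      have "?C k i l = A k i (\<sigma> l) * weight k (\<sigma> l) / (a l * b l)"
        by (rule cls_factor_eq[OF \<sigma> ab A1 A2 L that l])
      also have "\<dots> = A k i (\<sigma> l) / ?g k * z"
        unfolding z_def gw[OF that(1), symmetric] using g[OF that(1)] by simp
      finally show ?thesis .
    qed
    let ?q = "d - 1"
    have q: "?q \<in> {2..<d}" using d by auto
    have Dq: "{2..<d} - {?q} = {2..<?q}" using d by auto
    have Dsub: "k \<in> {2..<d}" if "k \<in> {2..<?q}" for k using that by auto
    have Fk: "?F k (idx ! k) l = ?x k / ?g k * z" if "k \<in> {2..<?q}" for k
      using C[OF Dsub[OF that] idx_lt] that by (auto simp: atd_factors_def)
    have Fq: "?F ?q (idx ! ?q) l = ?x ?q / ?g ?q * z / z ^ card {2..<?q}"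
    proof -
      have "(\<Prod>k'\<in>{2..<?q}. ?C k' (istar k') l) = (\<Prod>k'\<in>{2..<?q}. z)"
        using C[OF Dsub istar[OF Dsub]] g Dsub by (intro prod.cong) auto
      also have "\<dots> = z ^ card {2..<?q}" by (rule prod_constant)
      finally have "(\<Prod>k'\<in>{2..<?q}. ?C k' (istar k') l) = z ^ card {2..<?q}" .
      moreover have "d - Suc 0 \<noteq> Suc 0" using d by simp
      ultimately show ?thesis using C[OF q idx_lt] d by (simp add: atd_factors_def)
    qed
    have "(\<Prod>k<d. ?F k (idx ! k) l) = ?F 0 (idx ! 0) l * (?F 1 (idx ! 1) l * (?F ?q (idx ! ?q) l *
        (\<Prod>k\<in>{2..<?q}. ?F k (idx ! k) l)))"
      unfolding prod_modes_split[OF q] Dq ..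
    also have "(\<Prod>k\<in>{2..<?q}. ?F k (idx ! k) l) = (\<Prod>k\<in>{2..<?q}. ?x k / ?g k * z)"
      by (rule prod.cong) (use Fk in auto)
    also have "\<dots> = (\<Prod>k\<in>{2..<?q}. ?x k) / (\<Prod>k\<in>{2..<?q}. ?g k) * z ^ card {2..<?q}"
      by (simp add: prod.distrib prod_dividef)
    also have "?F 0 (idx ! 0) l = a l * ?x 0" using A1[OF l idx_lt] d by (simp add: atd_factors_def)
    also have "?F 1 (idx ! 1) l = b l * ?x 1" using A2[OF l] idx_lt[of 1] d by (simp add: atd_factors_def)
    also have "a l * ?x 0 * (b l * ?x 1 * (?F ?q (idx ! ?q) l *
        ((\<Prod>k\<in>{2..<?q}. ?x k) / (\<Prod>k\<in>{2..<?q}. ?g k) * z ^ card {2..<?q})))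
      = ?x 0 * (?x 1 * (?x ?q * (\<Prod>k\<in>{2..<?q}. ?x k)))"
    proof -
      have gD: "(\<Prod>k\<in>{2..<?q}. ?g k) \<noteq> 0" using g Dsub by simp
      have "z = ?g ?q * (\<Prod>k\<in>{2..<?q}. ?g k) / (a l * b l)"
        unfolding z_def using prod.remove[of "{2..<d}" ?q ?g] q Dq by simp
      then have zz: "a l * b l * z = ?g ?q * (\<Prod>k\<in>{2..<?q}. ?g k)" using ab[OF l] by simp
      have "a l * ?x 0 * (b l * ?x 1 * (?F ?q (idx ! ?q) l *
          ((\<Prod>k\<in>{2..<?q}. ?x k) / (\<Prod>k\<in>{2..<?q}. ?g k) * z ^ card {2..<?q})))
        = (a l * b l * z) * (?x 0 * (?x 1 * (?x ?q * (\<Prod>k\<in>{2..<?q}. ?x k)))) / (?g ?q * (\<Prod>k\<in>{2..<?q}. ?g k))"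
        unfolding Fq using z g[OF q] gD by (simp add: field_simps)
      then show ?thesis unfolding zz using g[OF q] gD by simp
    qed
    also have "\<dots> = (\<Prod>k<d. ?x k)" unfolding prod_modes_split[OF q] Dq ..
    finally show ?thesis .
  qed
  then have "cp_entry d r ?F idx = (\<Sum>l<r. \<Prod>k<d. A k (idx ! k) (\<sigma> l))"
    by (simp add: cp_entry_def)
  also have "\<dots> = cp_entry d r A idx"
    unfolding cp_entry_def by (rule sum.reindex_bij_betw[OF \<sigma>])
  finally show ?thesis using T[OF idx] by simp
qed

lemma slice_amc_low_rank:
  assumes f: "f \<in> good_tapes S (ns 0) (ns 1) w r (A 0)" and i3: "i3 \<in> S" "i3 < ns 2"
  shows "amc_low_rank (ns 0) (ns 1) r w (A 0) (\<lambda>i l. A 1 i l * (A 2 i3 l * weight 2 l)) (slice_of d T istar i3) (f i3)"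
proof
  show "slice_of d T istar i3 a i = (\<Sum>l<r. A 0 a l * (A 1 i l * (A 2 i3 l * weight 2 l)))"
    if "a < ns 0" "i < ns 1" for a i
    using T_fiber[of 2 a i i3] that i3 d by (simp add: slice_of_def)
  fix t assume t: "t \<le> r"
  \<comment> \<open>The tape holds draws up to index \<open>ns 1\<close> only; full column rank of
    the second factor keeps the indices up to \<open>r\<close> in range.\<close>
  have "r \<le> ns 1" using ind1 by (rule indep_cols_le_rows)
  then have ft: "f i3 t \<in> k_subsets (ns 0) w - unresolving_sets (ns 0) r (A 0) w"
    using f t i3 amc_tapesD[of f S "ns 0" "ns 1" w i3 t] by (auto simp: good_tapes_def)
  then show "f i3 t \<in> k_subsets (ns 0) w" by blast
  fix y a assume y: "\<And>b. b \<in> f i3 t \<Longrightarrow> (\<Sum>l<r. A 0 b l * y l) = 0" and a: "a < ns 0"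
  let ?v = "\<lambda>i. if i < ns 0 then \<Sum>l<r. A 0 i l * y l else 0"
  have "?v a = 0"
    by (rule resolving_imp_zero[OF ft _ _ a]) (use y in \<open>auto simp: col_space_def\<close>)
  then show "(\<Sum>l<r. A 0 a l * y l) = 0" using a by simp
qed

text \<open>Samples are counted with repetition. Filtering the product list enumerates each element
  of \<open>L\<close> once, so every direction costs \<open>r\<close> fibers of full length.\<close>

lemma length_atd_queries:
  assumes S: "finite S"
    and obs: "\<And>i3. i3 \<in> S \<Longrightarrow> length (snd (snd (snd (atd_completed d ns T istar \<omega> i3)))) \<le> N"
    and L: "kr_independent_rows (ns 0) (ns 1) r A1 A2 L"
  shows "length (atd_queries d ns T S istar \<omega> L) \<le> card S * N + r * (\<Sum>k\<in>{2..<d}. ns k)"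
proof -
  let ?ps = "filter (\<lambda>p. p \<in> L) (List.product [0..<ns 0] [0..<ns 1])"
  have "set ?ps = L" using L by (auto simp: kr_independent_rows_def)
  moreover have "distinct ?ps" by (simp add: distinct_product)
  ultimately have ps: "length ?ps = r"
    using L distinct_card[of ?ps] by (simp add: kr_independent_rows_def)
  have one: "(\<Sum>x\<leftarrow>sorted_list_of_set S. length (snd (snd (snd (atd_completed d ns T istar \<omega> x))))) \<le> card S * N"
  proof -
    have "(\<Sum>x\<leftarrow>sorted_list_of_set S. length (snd (snd (snd (atd_completed d ns T istar \<omega> x)))))
        \<le> (\<Sum>x\<leftarrow>sorted_list_of_set S. N)"
      by (rule sum_list_mono) (use obs S in auto)
    then show ?thesis using S by (simp add: sum_list_triv)
  qed
  have two: "(\<Sum>k\<leftarrow>[2..<d]. length (concat (map (\<lambda>p. map (\<lambda>i. fiber_index d istar k (fst p) (snd p) i) [0..<ns k]) ?ps)))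
      = r * (\<Sum>k\<in>{2..<d}. ns k)"
    by (simp add: length_concat o_def sum_list_triv ps[unfolded One_nat_def] interv_sum_list_conv_sum_set_nat sum_distrib_left
        del: filter.simps List.product.simps)
  show ?thesis
    unfolding atd_queries_def length_append
    using one two by (simp only: length_concat map_map o_def length_map)
qed

lemma mixed_slices_factor:
  assumes X: "\<And>i3 a b. i3 \<in> S \<Longrightarrow> a < ns 0 \<Longrightarrow> b < ns 1 \<Longrightarrow>
      X i3 a b = (\<Sum>l<r. A 0 a l * (A 1 b l * (A 2 i3 l * weight 2 l)))"
    and S: "finite S" and ij: "i < ns 0" "j < ns 1"
  shows "jennrich_mix S X u i j = (\<Sum>l<r. A 0 i l *
    ((\<Sum>t<card S. A 2 (sorted_list_of_set S ! t) l * weight 2 l * u t) * A 1 j l))"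
proof -
  have mem: "sorted_list_of_set S ! t \<in> S" if "t < card S" for t
    using S that nth_mem[of t "sorted_list_of_set S"] by simp
  have "jennrich_mix S X u i j = (\<Sum>t<card S. \<Sum>l<r. A 0 i l *
      (A 2 (sorted_list_of_set S ! t) l * weight 2 l * u t * A 1 j l))"
    unfolding jennrich_mix_def
  proof (rule sum.cong)
    fix t assume "t \<in> {..<card S}"
    then have "X (sorted_list_of_set S ! t) i j
        = (\<Sum>l<r. A 0 i l * (A 1 j l * (A 2 (sorted_list_of_set S ! t) l * weight 2 l)))"
      using X mem ij by simp
    then show "u t * X (sorted_list_of_set S ! t) i j
        = (\<Sum>l<r. A 0 i l * (A 2 (sorted_list_of_set S ! t) l * weight 2 l * u t * A 1 j l))"
      by (simp add: sum_distrib_left mult_ac)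
  qed simp
  also have "\<dots> = (\<Sum>l<r. A 0 i l *
    ((\<Sum>t<card S. A 2 (sorted_list_of_set S ! t) l * weight 2 l * u t) * A 1 j l))"
    by (subst sum.swap) (simp only: sum_distrib_left sum_distrib_right)
  finally show ?thesis .
qed

text \<open>The event is a rectangle, good tapes times separated Gaussian pairs. The second side has
  probability 1, so the failure probability comes from the tapes alone.\<close>

lemma adaptive_tensor_deli_correct:
  assumes s: "1 \<le> s" and \<delta>: "0 < \<delta>" "\<delta> < 1" and \<mu>: "0 < \<mu>" "coherence (ns 0) r (A 0) \<le> \<mu>"
    and kr: "2 \<le> kruskal_rank S r (A 2)" and S: "S \<subseteq> {..<ns 2}" "card S = s"
  defines "\<Omega> \<equiv> atd_space S (ns 0) (ns 1) (amc_rows 3 \<mu> r \<delta> (ns 0))"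
  shows "\<exists>E\<in>sets \<Omega>. measure \<Omega> E \<ge> 1 - real s * \<delta> \<and>
       (\<forall>\<omega>\<in>E.
          (\<exists>A1 A2 L. atd_admissible d ns r T S istar \<omega> A1 A2 L) \<and>
          (\<forall>A1 A2 L. atd_admissible d ns r T S istar \<omega> A1 A2 L \<longrightarrow>
             (\<forall>idx\<in>tensor_index_set d ns.
                 cp_entry d r (atd_factors d r T istar A1 A2 L) idx = T idx) \<and>
             real (length (atd_queries d ns T S istar \<omega> L))
               \<le> 4 * real s * real (ns 1) * max 1 (\<mu> * real r * ln (real r / \<delta>))
                 + real s * real (ns 0) * real r + real r * (\<Sum>k\<in>{2..<d}. real (ns k))))"
proof -
  define w where "w = amc_rows 3 \<mu> r \<delta> (ns 0)"
  define h where "h = sorted_list_of_set S"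
  \<comment> \<open>The l-th entry of D_u is the sum of \<open>\<alpha> l j * u j\<close>;
    \<open>h\<close> is the order in which \<open>jennrich_mix\<close> runs through
    \<open>S\<close>.\<close>
  define \<alpha> where "\<alpha> l j = A 2 (h ! j) l * weight 2 l" for l j
  define good where "good = good_tapes S (ns 0) (ns 1) w r (A 0)"
  define G where "G = Pi\<^sub>M {..<s} (\<lambda>_. density lborel std_normal_density)"
  define UV where "UV = {\<omega>\<in>space (G \<Otimes>\<^sub>M G). separated_mixes s r \<alpha> (fst \<omega>) (snd \<omega>)}"
  let ?pmf = "pmf_of_set (amc_tapes S (ns 0) (ns 1) w)"
  have fS: "finite S" using S(1) finite_subset by blast
  have r2: "2 \<le> r" by (rule kruskal_rank_ge_2D(1)[OF kr])
  have rn: "r \<le> ns 0" "r \<le> ns 1" using ind0 ind1 indep_cols_le_rows by blast+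
  have h_mem: "h ! j \<in> S" if "j < s" for j
    using fS S(2) that nth_mem[of j h] by (simp add: h_def)
  have h_onto: "\<exists>j<s. h ! j = i" if "i \<in> S" for i
    using that fS S(2) in_set_conv_nth[of i h] by (auto simp: h_def)
  have nz: "\<exists>j<s. \<alpha> l j \<noteq> 0" if l: "l < r" for l
  proof (intro exI[of _ 0] conjI)
    show "0 < s" using s by simp
    then have "h ! 0 \<in> S" by (rule h_mem)
    then have "A 2 (h ! 0) l \<noteq> 0" using nonzero[of 2 "h ! 0" l] S(1) d l by auto
    then show "\<alpha> l 0 \<noteq> 0" using weight_nonzero[OF l] by (simp add: \<alpha>_def)
  qed
  have ind: "c = 0" if l: "l < r" "l' < r" "l \<noteq> l'" and z: "\<And>j. j < s \<Longrightarrow> c * \<alpha> l j + c' * \<alpha> l' j = 0"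
    for l l' c c'
  proof -
    \<comment> \<open>This is the instance at \<open>l\<close> of the coefficient function below.
      The weights enter the coefficients because \<open>\<alpha>\<close> contains them, whereas the
      Kruskal rank concerns \<open>A 2\<close> alone.\<close>
    have "(if l = l then c * weight 2 l else c' * weight 2 l') = 0"
    proof (rule indep_colsD[where c = "\<lambda>m. if m = l then c * weight 2 l else c' * weight 2 l'",
          OF kruskal_rank_ge_2D(2)[OF kr l]])
      fix i assume "i \<in> S"
      then obtain j where "j < s" "h ! j = i" using h_onto by blast
      then show "(\<Sum>m\<in>{l, l'}. A 2 i m * (if m = l then c * weight 2 l else c' * weight 2 l')) = 0"
        using z[of j] l(3) by (simp add: \<alpha>_def mult_ac)
    qed simp
    then show ?thesis using weight_nonzero[OF l(1)] by simp
  qed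
  have UV: "UV \<in> sets (G \<Otimes>\<^sub>M G)" and AE_UV: "AE \<omega> in G \<Otimes>\<^sub>M G. separated_mixes s r \<alpha> (fst \<omega>) (snd \<omega>)"
    unfolding UV_def G_def by (rule AE_separated_mixes; use nz ind in blast)+
  interpret G: prob_space G unfolding G_def by (rule prob_space_PiM) (rule prob_space_std_normal)
  interpret GG: pair_prob_space G G ..
  interpret GG: prob_space "G \<Otimes>\<^sub>M G" by (rule GG.prob_space_axioms)
  have \<Omega>: "\<Omega> = measure_pmf ?pmf \<Otimes>\<^sub>M (G \<Otimes>\<^sub>M G)"
    unfolding \<Omega>_def atd_space_def w_def[symmetric] G_def S(2) ..
  have E: "good \<times> UV \<in> sets \<Omega>" unfolding \<Omega> by (rule pair_measureI) (use UV in auto)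
  have "emeasure (G \<Otimes>\<^sub>M G) UV = 1"
  proof (rule GG.emeasure_eq_1_AE[OF UV])
    show "AE \<omega> in G \<Otimes>\<^sub>M G. \<omega> \<in> UV"
      using AE_UV AE_space by eventually_elim (simp add: UV_def)
  qed
  then have "emeasure \<Omega> (good \<times> UV) = emeasure (measure_pmf ?pmf) good"
    unfolding \<Omega> using GG.emeasure_pair_measure_Times[of good "measure_pmf ?pmf" UV] UV by simp
  then have "measure \<Omega> (good \<times> UV) = measure (measure_pmf ?pmf) good" by (simp add: measure_def)
  then have prob: "measure \<Omega> (good \<times> UV) \<ge> 1 - real s * \<delta>"
    using prob_good_tapes_ge[OF \<mu>(2,1) r2 _ \<delta> fS rn(2)] rn(1) r2 S(2) by (simp add: good_def w_def)
  have "(\<exists>A1 A2 L. atd_admissible d ns r T S istar \<omega> A1 A2 L) \<and>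
      (\<forall>A1 A2 L. atd_admissible d ns r T S istar \<omega> A1 A2 L \<longrightarrow>
         (\<forall>idx\<in>tensor_index_set d ns. cp_entry d r (atd_factors d r T istar A1 A2 L) idx = T idx) \<and>
         real (length (atd_queries d ns T S istar \<omega> L))
           \<le> 4 * real s * real (ns 1) * max 1 (\<mu> * real r * ln (real r / \<delta>))
             + real s * real (ns 0) * real r + real r * (\<Sum>k\<in>{2..<d}. real (ns k)))"
    if \<omega>: "\<omega> \<in> good \<times> UV" for \<omega>
  proof -
    have f: "fst \<omega> \<in> good_tapes S (ns 0) (ns 1) w r (A 0)"
      and sep: "separated_mixes s r \<alpha> (fst (snd \<omega>)) (snd (snd \<omega>))"
      using \<omega> by (auto simp: good_def UV_def)
    note low_rank = slice_amc_low_rank[OF f]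
    let ?X = "\<lambda>i3. fst (snd (snd (atd_completed d ns T istar \<omega> i3)))"
    have X: "?X i3 a b = (\<Sum>l<r. A 0 a l * (A 1 b l * (A 2 i3 l * weight 2 l)))"
      if "i3 \<in> S" "a < ns 0" "b < ns 1" for i3 a b
    proof -
      have i3: "i3 < ns 2" using that S(1) by auto
      show ?thesis
        using amc_low_rank.amc_correct(1)[OF low_rank[OF that(1) i3] that(2,3)]
          amc_low_rank.rep[OF low_rank[OF that(1) i3] that(2,3)]
        by (simp add: atd_completed_def)
    qed
    have obs: "length (snd (snd (snd (atd_completed d ns T istar \<omega> i3)))) \<le> ns 1 * w + ns 0 * r"
      if "i3 \<in> S" for i3
      using amc_low_rank.amc_correct(2)[OF low_rank[OF that]] that S(1)
      by (auto simp: atd_completed_def)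
    let ?Xu = "jennrich_mix S ?X (fst (snd \<omega>))" and ?Xv = "jennrich_mix S ?X (snd (snd \<omega>))"
    let ?e = "\<lambda>u l. \<Sum>j<s. \<alpha> l j * u j"
    have mix: "jennrich_mix S ?X u i j = (\<Sum>l<r. A 0 i l * (?e u l * A 1 j l))"
      if "i < ns 0" "j < ns 1" for u i j
      using mixed_slices_factor[OF X fS that] by (simp add: \<alpha>_def h_def S(2))
    interpret J: jennrich_setting "ns 0" "ns 1" r "A 0" "A 1" ?Xu ?Xv "?e (fst (snd \<omega>))" "?e (snd (snd \<omega>))"
    proof
      show "indep_cols {..<ns 0} (A 0) {..<r}" "indep_cols {..<ns 1} (A 1) {..<r}"
        by (rule ind0, rule ind1)
    qed (use mix sep in \<open>auto simp: separated_mixes_def\<close>)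
    have "\<exists>L\<subseteq>{..<ns 0} \<times> {..<ns 1}. card L = card {..<r} \<and>
        (\<forall>y. (\<forall>l\<in>{..<r}. (\<Sum>p\<in>L. y p * (A 0 (fst p) l * A 1 (snd p) l)) = 0) \<longrightarrow> (\<forall>p\<in>L. y p = 0))"
      by (rule independent_rows_exist) (simp, simp, rule khatri_rao_indep[OF ind0 ind1])
    then obtain L where "L \<subseteq> {..<ns 0} \<times> {..<ns 1}" "card L = card {..<r}"
      "\<forall>y. (\<forall>l\<in>{..<r}. (\<Sum>p\<in>L. y p * (A 0 (fst p) l * A 1 (snd p) l)) = 0) \<longrightarrow> (\<forall>p\<in>L. y p = 0)"
      by (elim exE conjE)
    then have "kr_independent_rows (ns 0) (ns 1) r (A 0) (A 1) L"
      unfolding kr_independent_rows_def by (simp add: Ball_def)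
    then have ex: "\<exists>A1 A2 L. atd_admissible d ns r T S istar \<omega> A1 A2 L"
      using J.jennrich_output_factors unfolding atd_admissible_def Let_def by blast
    have correct: "cp_entry d r (atd_factors d r T istar A1 A2 L) idx = T idx"
      if adm: "atd_admissible d ns r T S istar \<omega> A1 A2 L" and idx: "idx \<in> tensor_index_set d ns" for A1 A2 L idx
    proof -
      have out: "jennrich_output (ns 0) (ns 1) r ?Xu ?Xv A1 A2"
        and L: "kr_independent_rows (ns 0) (ns 1) r A1 A2 L"
        using adm by (auto simp: atd_admissible_def Let_def)
      obtain \<sigma> a b where \<sigma>: "bij_betw \<sigma> {..<r} {..<r}"
        and ab: "\<forall>l<r. a l \<noteq> 0 \<and> b l \<noteq> 0 \<and>
          (\<forall>i<ns 0. A1 i l = a l * A 0 i (\<sigma> l)) \<and> (\<forall>i<ns 1. A2 i l = b l * A 1 i (\<sigma> l))"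
        using J.jennrich_output_unique[OF out] by (elim exE conjE)
      show ?thesis
        by (rule atd_factors_correct[OF \<sigma> _ _ _ L idx, of a b]) (use ab in simp_all)
    qed
    have count: "real (length (atd_queries d ns T S istar \<omega> L))
        \<le> 4 * real s * real (ns 1) * max 1 (\<mu> * real r * ln (real r / \<delta>))
             + real s * real (ns 0) * real r + real r * (\<Sum>k\<in>{2..<d}. real (ns k))"
      if adm: "atd_admissible d ns r T S istar \<omega> A1 A2 L" for A1 A2 L
    proof -
      let ?x = "\<mu> * real r * ln (real r / \<delta>)"
      have L: "kr_independent_rows (ns 0) (ns 1) r A1 A2 L"
        using adm by (auto simp: atd_admissible_def Let_def)
      have "0 \<le> ?x" using \<mu>(1) \<delta> r2 by (intro mult_nonneg_nonneg ln_ge_zero) (auto simp: le_divide_eq)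
      \<comment> \<open>Rounding up costs at most 1, and 3x + 1 \<le> 4 max 1 x; this is the origin
        of the constant 4.\<close>
      then have "real (nat \<lceil>3 * ?x\<rceil>) \<le> 4 * max 1 ?x" by (simp add: of_nat_nat max_def) linarith
      moreover have "w \<le> nat \<lceil>3 * ?x\<rceil>" by (simp add: w_def amc_rows_def mult.assoc)
      ultimately have w: "real w \<le> 4 * max 1 ?x" by linarith
      have "real (length (atd_queries d ns T S istar \<omega> L))
          \<le> real (s * (ns 1 * w + ns 0 * r) + r * (\<Sum>k\<in>{2..<d}. ns k))"
        using length_atd_queries[OF fS obs L] S(2) by (simp only: of_nat_le_iff)
      also have "\<dots> = real s * real (ns 1) * real w + real s * real (ns 0) * real r + real r * (\<Sum>k\<in>{2..<d}. real (ns k))"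
        by (simp add: algebra_simps)
      also have "\<dots> \<le> real s * real (ns 1) * (4 * max 1 ?x) + real s * real (ns 0) * real r + real r * (\<Sum>k\<in>{2..<d}. real (ns k))"
        using w by (intro add_right_mono mult_left_mono) auto
      finally show ?thesis by (simp only: mult_ac)
    qed
    show ?thesis using ex correct count by blast
  qed
  then show ?thesis using E prob by (intro bexI[of _ "good \<times> UV"]) auto
qed

end

theorem theorem3:
  shows "\<exists>C>0. \<exists>K>0. \<forall>d ns r (A :: nat \<Rightarrow> mat) T (s :: nat) (\<delta> :: real) (\<mu>0 :: real) S istar.
    3 \<le> d \<and>
    (\<forall>idx\<in>tensor_index_set d ns. T idx = cp_entry d r A idx) \<and>
    1 \<le> s \<and> 0 < \<delta> \<and> \<delta> < 1 \<and> 0 < \<mu>0 \<and>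
    coherence (ns 0) r (A 0) \<le> \<mu>0 \<and>
    mat_rank (ns 0) r (A 0) = r \<and> mat_rank (ns 1) r (A 1) = r \<and>
    (\<forall>R. R \<subseteq> {..<ns 2} \<and> card R = s \<longrightarrow> 2 \<le> kruskal_rank R r (A 2)) \<and>
    (\<forall>k\<in>{2..<d}. \<forall>i<ns k. \<forall>l<r. A k i l \<noteq> 0) \<and>
    S \<subseteq> {..<ns 2} \<and> card S = s \<and> (\<forall>k\<in>{2..<d}. istar k < ns k)
    \<longrightarrow>
    (let \<Omega> = atd_space S (ns 0) (ns 1) (amc_rows C \<mu>0 r \<delta> (ns 0)) in
     \<exists>E\<in>sets \<Omega>. measure \<Omega> E \<ge> 1 - real s * \<delta> \<and>
       (\<forall>\<omega>\<in>E.
          (\<exists>A1 A2 L. atd_admissible d ns r T S istar \<omega> A1 A2 L) \<and>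
          (\<forall>A1 A2 L. atd_admissible d ns r T S istar \<omega> A1 A2 L \<longrightarrow>
             (\<forall>idx\<in>tensor_index_set d ns.
                 cp_entry d r (atd_factors d r T istar A1 A2 L) idx = T idx) \<and>
             real (length (atd_queries d ns T S istar \<omega> L))
               \<le> K * real s * real (ns 1) * max 1 (\<mu>0 * real r * ln (real r / \<delta>))
                 + real s * real (ns 0) * real r + real r * (\<Sum>k\<in>{2..<d}. real (ns k)))))"
proof (rule exI[of _ 3], intro conjI, simp, rule exI[of _ 4], intro conjI allI impI, goal_cases)
  case (2 d ns r A T s \<delta> \<mu>0 S istar)
  interpret cp_tensor d r ns istar A T
    by unfold_locales (use 2 mat_rank_fullD in auto)
  show ?case
    unfolding Let_def by (rule adaptive_tensor_deli_correct) (use 2 in auto)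
qed simp

end
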